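(* Let $G$ be a standard special group. Consider the following conditions: (i) $G$ is not formally real. (ii) Every involution of $\mathrm{Gal}(G)$ lies in $\Phi(\mathrm{Gal}(G))$. (iii) Every involution of $\mathrm{Gal}(G)$ is central. Then (i) $\Rightarrow$ (ii) $\Rightarrow$ (iii), and if $\mathrm{card}(\mathrm{Gal}(G))>2$ then all three conditions are equivalent.
   Context: Notation: $\mathbb Z_2=\mathbb Z/2\mathbb Z$, $\mathbb Z_4=\mathbb Z/4\mathbb Z$, $\mathbb D_4$ is the dihedral group of order 8. $\Phi(\mathcal G)$ is the Frattini subgroup of a profinite group (intersection of the maximal open subgroups). Special group: a multiplicative group $G$ of exponent 2 with a distinguished element $-1$ (write $-a=(-1)a$) and a binary relation $\equiv$ on $G\times G$, written $\langle a,b\rangle\equiv\langle c,d\rangle$, such that: $\equiv$ is an equivalence relation; $\langle a,b\rangle\equiv\langle b,a\rangle$; $\langle a,-a\rangle\equiv\langle1,-1\rangle$; $\langle a,b\rangle\equiv\langle c,d\rangle$ implies $ab=cd$, implies $\langle a,-c\rangle\equiv\langle -b,d\rangle$, and implies $\langle ga,gb\rangle\equiv\langle gc,gd\rangle$ for all $g\in G$ (these axioms define a pre-special group); and the following relation on triples is transitive: $\langle a_1,a_2,a_3\rangle\equiv\langle b_1,b_2,b_3\rangle$ iff there are $x,y,z\in G$ with $\langle a_1,x\rangle\equiv\langle b_1,y\rangle$, $\langle a_2,a_3\rangle\equiv\langle x,z\rangle$, $\langle b_2,b_3\rangle\equiv\langle y,z\rangle$. Put $D_G(1,a)=\{b\in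 G:\langle b,ba\rangle\equiv\langle1,a\rangle\}$. A subgroup $\Delta\subseteq G$ is saturated if $a\in\Delta$ implies $D_G(1,a)\subseteq\Delta$. An ordering of $G$ is a maximal element among the proper saturated subgroups; $G$ is formally real if it has an ordering. K-theory: $k_1(G)$ is $G$ written additively, via the isomorphism $l:G\to k_1(G)$, $l(ab)=l(a)+l(b)$; $k_*(G)$ is the quotient of the tensor $\mathbb Z_2$-algebra of $k_1(G)$ by the ideal generated by all $l(a)\otimes l(ab)$ with $a\in D_G(1,b)$; $k_2(G)$ is its degree 2 part. $G$ is $k$-stable if for all $a,b,c,d\in G$ with $ab=cd$: $\langle a,b\rangle\equiv\langle c,d\rangle$ iff $l(a)l(b)=l(c)l(d)$ in $k_2(G)$. Galois group: let $B=\{a_i:i\in I\}$ be a well-ordered $\mathbb Z_2$-basis of $G$ ($I$ well-ordered). $\mathcal W(B)$ is the set of triples $(\alpha,\beta,\gamma)$, $\alpha=(\alpha_i)_{i\in I}$, $\beta=(\beta_{ij})_{i<j}$, $\gamma=(\gamma_i)_{i\in I}$ with entries in $\mathbb Z_2$, with the product topology and the group law $(\alpha,\beta,\gamma)(\alpha',\beta',\gamma')=\big((\alpha_i+\alpha_i'+\gamma_i\gamma_i')_i,(\beta_{ij}+\beta'_{ij}+\gamma'_i\gamma_j)_{i<j},(\gamma_i+\gamma_i')_i\big)$; it is a pro-2-group with Frattini subgroup $\Phi(B)=\{\gamma=0\}$. $P_2(B)$ is the $\mathbb Z_2$-vector space with basis the monomials $z_i^2$ ($i\in I$) and $z_iz_j$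 ($i<j$); it is paired with $\Phi(B)$ by $\langle(\alpha,\beta,0),\sum c_iz_i^2+\sum_{i<j}d_{ij}z_iz_j\rangle=\sum c_i\alpha_i+\sum_{i<j}d_{ij}\beta_{ij}$. $Q(B)$ is the kernel of the linear map $P_2(B)\to k_2(G)$, $z_i^2\mapsto l(a_i)l(a_i)$, $z_iz_j\mapsto l(a_i)l(a_j)$, and $\mathcal V(B)=Q(B)^{\perp}\subseteq\Phi(B)$, a closed central subgroup of $\mathcal W(B)$. $\mathcal G=\mathrm{Gal}(G)=\mathcal W(B)/\mathcal V(B)$, for an arbitrary fixed well-ordered basis $B$. For $a=\prod_i a_i^{\varepsilon_i}\in G$, $M_a\subseteq\mathcal G$ is the subgroup of classes of $(\alpha,\beta,\gamma)$ with $\sum_i\varepsilon_i\gamma_i=0$. Standard: $G$ is standard if it is $k$-stable and (1) for every $a\in G\setminus\{1\}$, if there is a clopen normal subgroup $S\subseteq\mathcal G$ with $\mathcal G/S\cong\mathbb Z_4$ and $S\subseteq M_a$, then $l(a)l(a)=0$ in $k_2(G)$; (2) for all $a,b\in G\setminus\{1\}$ with $a\ne b$, if there is a clopen normal subgroup $D\subseteq\mathcal G$ with $\mathcal G/D\cong\mathbb D_4$, $D\subseteq M_a\cap M_b$ and $M_{ab}/D\cong\mathbb Z_4$, then $l(a)l(b)=0$ in $k_2(G)$. *)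

theory Defs
  imports
    "HOL-Library.Z2"
    "HOL-Algebra.Algebra"
    "HOL-Analysis.Analysis"
begin

section \<open>Special groups\<close>

text \<open>
  \<^term>\<open>((a, b), (c, d)) \<in> feq G\<close> is the isometry of binary forms written
  \<open>\<langle>a,b\<rangle> \<equiv> \<langle>c,d\<rangle>\<close>; \<open>mone G\<close> is the distinguished element \<open>-1\<close>.
\<close>

record 'a special_group = "'a monoid" +
  mone :: 'a
  feq :: "(('a \<times> 'a) \<times> ('a \<times> 'a)) set"

definition neg :: "('a, 'm) special_group_scheme \<Rightarrow> 'a \<Rightarrow> 'a"
  where "neg G a = mone G \<otimes>\<^bsub>G\<^esub> a"

text \<open>
  ``Exponent 2'' means that every square is trivial, so the one-element group is allowed.
\<close>

locale pre_special_group = group G for G :: "('a, 'm) special_group_scheme" (structure) +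
  assumes square_one: "a \<in> carrier G \<Longrightarrow> a \<otimes> a = \<one>"
    and mone_closed: "mone G \<in> carrier G"
    and feq_equiv: "equiv (carrier G \<times> carrier G) (feq G)"
    and feq_commute: "\<lbrakk>a \<in> carrier G; b \<in> carrier G\<rbrakk> \<Longrightarrow> ((a, b), (b, a)) \<in> feq G"
    and feq_hyperbolic: "a \<in> carrier G \<Longrightarrow> ((a, neg G a), (\<one>, mone G)) \<in> feq G"
    and feq_discriminant: "((a, b), (c, d)) \<in> feq G \<Longrightarrow> a \<otimes> b = c \<otimes> d"
    and feq_exchange: "((a, b), (c, d)) \<in> feq G \<Longrightarrow> ((a, neg G c), (neg G b, d)) \<in> feq G"
    and feq_scale: "\<lbrakk>((a, b), (c, d)) \<in> feq G; g \<in> carrier G\<rbrakk>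
      \<Longrightarrow> ((g \<otimes> a, g \<otimes> b), (g \<otimes> c, g \<otimes> d)) \<in> feq G"

definition feq3 :: "('a, 'm) special_group_scheme \<Rightarrow> (('a \<times> 'a \<times> 'a) \<times> ('a \<times> 'a \<times> 'a)) set"
  where "feq3 G = {((a1, a2, a3), (b1, b2, b3)) | a1 a2 a3 b1 b2 b3.
     {a1, a2, a3, b1, b2, b3} \<subseteq> carrier G \<and>
     (\<exists>x \<in> carrier G. \<exists>y \<in> carrier G. \<exists>z \<in> carrier G.
        ((a1, x), (b1, y)) \<in> feq G \<and>
        ((a2, a3), (x, z)) \<in> feq G \<and>
        ((b2, b3), (y, z)) \<in> feq G)}"

locale special_group = pre_special_group G for G :: "('a, 'm) special_group_scheme" (structure) +
  assumes feq3_trans: "trans (feq3 G)"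

definition repr :: "('a, 'm) special_group_scheme \<Rightarrow> 'a \<Rightarrow> 'a set"
    \<comment> \<open>\<open>D\<^sub>G(1,a)\<close>\<close>
  where "repr G a = {b \<in> carrier G. ((b, b \<otimes>\<^bsub>G\<^esub> a), (\<one>\<^bsub>G\<^esub>, a)) \<in> feq G}"

definition saturated :: "('a, 'm) special_group_scheme \<Rightarrow> 'a set \<Rightarrow> bool"
  where "saturated G \<Delta> \<longleftrightarrow> subgroup \<Delta> G \<and> (\<forall>a \<in> \<Delta>. repr G a \<subseteq> \<Delta>)"

definition sg_ordering :: "('a, 'm) special_group_scheme \<Rightarrow> 'a set \<Rightarrow> bool"
  where "sg_ordering G P \<longleftrightarrow>
    saturated G P \<and> P \<noteq> carrier G \<and>
    (\<forall>\<Delta>. saturated G \<Delta> \<and> \<Delta> \<noteq> carrier G \<and> P \<subseteq> \<Delta> \<longrightarrow> \<Delta> = P)"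

definition formally_real :: "('a, 'm) special_group_scheme \<Rightarrow> bool"
  where "formally_real G \<longleftrightarrow> (\<exists>P. sg_ordering G P)"


section \<open>K-theory\<close>

text \<open>
  The free associative unital algebra over the field with two elements on a set of letters:
  finitely supported functions on words, with convolution along concatenation as product.
\<close>

definition free_algebra :: "'a set \<Rightarrow> ('a list \<Rightarrow> bit) ring"
  where "free_algebra S =
    \<lparr>carrier = {p. finite {w. p w \<noteq> 0} \<and> {w. p w \<noteq> 0} \<subseteq> lists S},
     monoid.mult = (\<lambda>p q w. \<Sum>(u, v) \<in> {(u, v). u @ v = w}. p u * q v),
     monoid.one = (\<lambda>w. if w = [] then 1 else 0),
     ring.zero = (\<lambda>w. 0),
     ring.add = (\<lambda>p q w. p w + q w)\<rparr>"

definition letter :: "'a \<Rightarrow> 'a list \<Rightarrow> bit"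
  where "letter a = (\<lambda>w. if w = [a] then 1 else 0)"

text \<open>
  The tensor algebra of \<open>k\<^sub>1(G)\<close>: the free algebra on letters \<open>l(a)\<close>, \<open>a \<in> G\<close>, modulo the
  relations \<open>l(ab) = l(a) + l(b)\<close>. (The only scalars are 0 and 1, so additivity is linearity.)
\<close>

definition add_rels :: "('a, 'm) special_group_scheme \<Rightarrow> ('a list \<Rightarrow> bit) set"
  where "add_rels G =
    (let F = free_algebra (carrier G) in
      {letter (a \<otimes>\<^bsub>G\<^esub> b) \<ominus>\<^bsub>F\<^esub> (letter a \<oplus>\<^bsub>F\<^esub> letter b) | a b.
         a \<in> carrier G \<and> b \<in> carrier G})"

definition tensor_algebra :: "('a, 'm) special_group_scheme \<Rightarrow> ('a list \<Rightarrow> bit) set ring"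
  where "tensor_algebra G =
    (let F = free_algebra (carrier G) in F Quot (Idl\<^bsub>F\<^esub> (add_rels G)))"

definition tgen :: "('a, 'm) special_group_scheme \<Rightarrow> 'a \<Rightarrow> ('a list \<Rightarrow> bit) set"
  where "tgen G a =
    (let F = free_algebra (carrier G) in (Idl\<^bsub>F\<^esub> (add_rels G)) +>\<^bsub>F\<^esub> letter a)"

definition k_rels :: "('a, 'm) special_group_scheme \<Rightarrow> ('a list \<Rightarrow> bit) set set"
  where "k_rels G =
    {tgen G a \<otimes>\<^bsub>tensor_algebra G\<^esub> tgen G (a \<otimes>\<^bsub>G\<^esub> b) | a b.
       b \<in> carrier G \<and> a \<in> repr G b}"

text \<open>
  \<open>k_ring G\<close> is the graded ring \<open>k\<^sub>*(G)\<close>. Its degree 2 part \<open>k\<^sub>2(G)\<close> is an additive subgroup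
  containing all products \<open>l(a)l(b)\<close>, so (in)equalities and sums of such products in
  \<open>k\<^sub>2(G)\<close> are expressed in \<open>k_ring G\<close>.
\<close>

definition k_ring :: "('a, 'm) special_group_scheme \<Rightarrow> ('a list \<Rightarrow> bit) set set ring"
  where "k_ring G = tensor_algebra G Quot (Idl\<^bsub>tensor_algebra G\<^esub> (k_rels G))"

definition kl :: "('a, 'm) special_group_scheme \<Rightarrow> 'a \<Rightarrow> ('a list \<Rightarrow> bit) set set"
  where "kl G a = (Idl\<^bsub>tensor_algebra G\<^esub> (k_rels G)) +>\<^bsub>tensor_algebra G\<^esub> tgen G a"

definition kprod :: "('a, 'm) special_group_scheme \<Rightarrow> 'a \<Rightarrow> 'a \<Rightarrow> ('a list \<Rightarrow> bit) set set"
  where "kprod G a b = kl G a \<otimes>\<^bsub>k_ring G\<^esub> kl G b"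

definition k_stable :: "('a, 'm) special_group_scheme \<Rightarrow> bool"
  where "k_stable G \<longleftrightarrow>
    (\<forall>a \<in> carrier G. \<forall>b \<in> carrier G. \<forall>c \<in> carrier G. \<forall>d \<in> carrier G.
       a \<otimes>\<^bsub>G\<^esub> b = c \<otimes>\<^bsub>G\<^esub> d \<longrightarrow>
       (((a, b), (c, d)) \<in> feq G \<longleftrightarrow> kprod G a b = kprod G c d))"


section \<open>The Galois group\<close>

text \<open>
  A well-ordered basis is a family \<open>B i\<close> indexed by a set \<open>I\<close> with a (reflexive) well-order
  \<open>r\<close>; thus \<open>i < j\<close> reads \<^term>\<open>(i, j) \<in> r - Id\<close>. Independence forces \<open>B\<close> to be
  injective on \<open>I\<close>.
\<close>

definition well_ordered_basis ::
    "('a, 'm) special_group_scheme \<Rightarrow> 'i set \<Rightarrow> 'i rel \<Rightarrow> ('i \<Rightarrow> 'a) \<Rightarrow> bool"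
  where "well_ordered_basis G I r B \<longleftrightarrow>
    well_order_on I r \<and> B ` I \<subseteq> carrier G \<and>
    (\<forall>J. finite J \<and> J \<subseteq> I \<and> finprod G B J = \<one>\<^bsub>G\<^esub> \<longrightarrow> J = {}) \<and>
    (\<forall>g \<in> carrier G. \<exists>J. finite J \<and> J \<subseteq> I \<and> finprod G B J = g)"

definition basis_support ::
    "('a, 'm) special_group_scheme \<Rightarrow> 'i set \<Rightarrow> ('i \<Rightarrow> 'a) \<Rightarrow> 'a \<Rightarrow> 'i set"
    \<comment> \<open>the set of indices whose exponent in the basis expansion of \<open>g\<close> is 1\<close>
  where "basis_support G I B g = (THE J. finite J \<and> J \<subseteq> I \<and> finprod G B J = g)"

type_synonym 'i gal_elt = "('i \<Rightarrow> bit) \<times> ('i \<times> 'i \<Rightarrow> bit) \<times> ('i \<Rightarrow> bit)"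

definition W_group :: "'i set \<Rightarrow> 'i rel \<Rightarrow> 'i gal_elt monoid"
  where "W_group I r =
    \<lparr>carrier = (I \<rightarrow>\<^sub>E UNIV) \<times> ((r - Id) \<rightarrow>\<^sub>E UNIV) \<times> (I \<rightarrow>\<^sub>E UNIV),
     monoid.mult = (\<lambda>(\<alpha>, \<beta>, \<gamma>) (\<alpha>', \<beta>', \<gamma>').
       (restrict (\<lambda>i. \<alpha> i + \<alpha>' i + \<gamma> i * \<gamma>' i) I,
        restrict (\<lambda>(i, j). \<beta> (i, j) + \<beta>' (i, j) + \<gamma>' i * \<gamma> j) (r - Id),
        restrict (\<lambda>i. \<gamma> i + \<gamma>' i) I)),
     one = (restrict (\<lambda>_. 0) I, restrict (\<lambda>_. 0) (r - Id), restrict (\<lambda>_. 0) I)\<rparr>"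

definition W_topology :: "'i set \<Rightarrow> 'i rel \<Rightarrow> 'i gal_elt topology"
  where "W_topology I r =
    prod_topology (product_topology (\<lambda>_. discrete_topology UNIV) I)
      (prod_topology (product_topology (\<lambda>_. discrete_topology UNIV) (r - Id))
        (product_topology (\<lambda>_. discrete_topology UNIV) I))"

definition W_Frattini :: "'i set \<Rightarrow> 'i rel \<Rightarrow> 'i gal_elt set"
    \<comment> \<open>\<open>\<Phi>(B)\<close>\<close>
  where "W_Frattini I r = {(\<alpha>, \<beta>, \<gamma>) \<in> carrier (W_group I r). \<forall>i \<in> I. \<gamma> i = 0}"

text \<open>
  \<open>P\<^sub>2(B)\<close> as finitely supported coefficient functions on the pairs \<open>i \<le> j\<close>: the pair
  \<open>(i, j)\<close> with \<open>i < j\<close> stands for \<open>z\<^sub>i z\<^sub>j\<close>, the pair \<open>(i, i)\<close> for the square of \<open>z\<^sub>i\<close>.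
\<close>

definition P2 :: "'i rel \<Rightarrow> ('i \<times> 'i \<Rightarrow> bit) set"
  where "P2 r = {q. finite {p. q p \<noteq> 0} \<and> {p. q p \<noteq> 0} \<subseteq> r}"

definition W_pairing :: "'i gal_elt \<Rightarrow> ('i \<times> 'i \<Rightarrow> bit) \<Rightarrow> bit"
  where "W_pairing = (\<lambda>(\<alpha>, \<beta>, \<gamma>) q.
    \<Sum>(i, j) \<in> {p. q p \<noteq> 0}. q (i, j) * (if i = j then \<alpha> i else \<beta> (i, j)))"

text \<open>
  Non-zero coefficients are 1, so the linear map \<open>P\<^sub>2(B) \<rightarrow> k\<^sub>2(G)\<close> sends \<open>q\<close> to the sum over
  its support.
\<close>

definition Q2 :: "('a, 'm) special_group_scheme \<Rightarrow> 'i rel \<Rightarrow> ('i \<Rightarrow> 'a) \<Rightarrow> ('i \<times> 'i \<Rightarrow> bit) set"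
  where "Q2 G r B =
    {q \<in> P2 r. finsum (k_ring G) (\<lambda>(i, j). kprod G (B i) (B j)) {p. q p \<noteq> 0} = \<zero>\<^bsub>k_ring G\<^esub>}"

definition V_group ::
    "('a, 'm) special_group_scheme \<Rightarrow> 'i set \<Rightarrow> 'i rel \<Rightarrow> ('i \<Rightarrow> 'a) \<Rightarrow> 'i gal_elt set"
  where "V_group G I r B = {w \<in> W_Frattini I r. \<forall>q \<in> Q2 G r B. W_pairing w q = 0}"

definition Gal ::
    "('a, 'm) special_group_scheme \<Rightarrow> 'i set \<Rightarrow> 'i rel \<Rightarrow> ('i \<Rightarrow> 'a) \<Rightarrow> 'i gal_elt set monoid"
  where "Gal G I r B = W_group I r Mod V_group G I r B"

definition quotient_topology :: "'b topology \<Rightarrow> ('b \<Rightarrow> 'c) \<Rightarrow> 'c topology"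
  where "quotient_topology T f =
    topology (\<lambda>U. U \<subseteq> f ` topspace T \<and> openin T {x \<in> topspace T. f x \<in> U})"

lemma openin_quotient_topology:
  "openin (quotient_topology T f) U \<longleftrightarrow>
     U \<subseteq> f ` topspace T \<and> openin T {x \<in> topspace T. f x \<in> U}"
proof -
  have "istopology (\<lambda>U. U \<subseteq> f ` topspace T \<and> openin T {x \<in> topspace T. f x \<in> U})"
    unfolding istopology_def
  proof (intro conjI allI impI)
    fix S Y
    assume S: "S \<subseteq> f ` topspace T \<and> openin T {x \<in> topspace T. f x \<in> S}"
      and Y: "Y \<subseteq> f ` topspace T \<and> openin T {x \<in> topspace T. f x \<in> Y}"
    then show "S \<inter> Y \<subseteq> f ` topspace T" by blast
    have "{x \<in> topspace T. f x \<in> S \<inter> Y} =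
        {x \<in> topspace T. f x \<in> S} \<inter> {x \<in> topspace T. f x \<in> Y}" by blast
    with S Y show "openin T {x \<in> topspace T. f x \<in> S \<inter> Y}" by (simp add: openin_Int)
  next
    fix K
    assume K: "\<forall>S\<in>K. S \<subseteq> f ` topspace T \<and> openin T {x \<in> topspace T. f x \<in> S}"
    then show "\<Union>K \<subseteq> f ` topspace T" by blast
    have "{x \<in> topspace T. f x \<in> \<Union>K} = (\<Union>S\<in>K. {x \<in> topspace T. f x \<in> S})" by blast
    with K show "openin T {x \<in> topspace T. f x \<in> \<Union>K}" by auto
  qed
  then show ?thesis
    unfolding quotient_topology_def by (simp add: topology_inverse')
qed

definition Gal_topology ::
    "('a, 'm) special_group_scheme \<Rightarrow> 'i set \<Rightarrow> 'i rel \<Rightarrow> ('i \<Rightarrow> 'a) \<Rightarrow> 'i gal_elt set topology"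
  where "Gal_topology G I r B =
    quotient_topology (W_topology I r) (\<lambda>w. V_group G I r B #>\<^bsub>W_group I r\<^esub> w)"

definition M_subgroup ::
    "('a, 'm) special_group_scheme \<Rightarrow> 'i set \<Rightarrow> 'i rel \<Rightarrow> ('i \<Rightarrow> 'a) \<Rightarrow> 'a \<Rightarrow> 'i gal_elt set set"
  where "M_subgroup G I r B a =
    {V_group G I r B #>\<^bsub>W_group I r\<^esub> (\<alpha>, \<beta>, \<gamma>) | \<alpha> \<beta> \<gamma>.
       (\<alpha>, \<beta>, \<gamma>) \<in> carrier (W_group I r) \<and> (\<Sum>i \<in> basis_support G I B a. \<gamma> i) = 0}"


section \<open>Topological groups, dihedral groups and involutions\<close>

definition maximal_open_subgroup :: "('g, 'm) monoid_scheme \<Rightarrow> 'g topology \<Rightarrow> 'g set \<Rightarrow> bool"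
  where "maximal_open_subgroup H T M \<longleftrightarrow>
    subgroup M H \<and> openin T M \<and> M \<noteq> carrier H \<and>
    (\<forall>N. subgroup N H \<and> openin T N \<and> N \<noteq> carrier H \<and> M \<subseteq> N \<longrightarrow> N = M)"

definition Frattini :: "('g, 'm) monoid_scheme \<Rightarrow> 'g topology \<Rightarrow> 'g set"
  where "Frattini H T = carrier H \<inter> \<Inter> {M. maximal_open_subgroup H T M}"

definition clopen_normal :: "('g, 'm) monoid_scheme \<Rightarrow> 'g topology \<Rightarrow> 'g set \<Rightarrow> bool"
  where "clopen_normal H T N \<longleftrightarrow> N \<lhd> H \<and> openin T N \<and> closedin T N"

text \<open>
  The dihedral group of order \<open>2n\<close> (for \<open>n > 0\<close>); the pair \<open>(k, s)\<close> is the rotation by \<open>k\<close>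
  steps, preceded by a fixed reflection if \<open>s\<close> holds.
\<close>

definition dihedral_group :: "nat \<Rightarrow> (int \<times> bool) monoid"
  where "dihedral_group n =
    \<lparr>carrier = {0..<int n} \<times> UNIV,
     monoid.mult = (\<lambda>(k, s) (k', s'). ((if s then k - k' else k + k') mod int n, s \<noteq> s')),
     one = (0, False)\<rparr>"

definition involution :: "('g, 'm) monoid_scheme \<Rightarrow> 'g \<Rightarrow> bool"
  where "involution H x \<longleftrightarrow> x \<in> carrier H \<and> x \<noteq> \<one>\<^bsub>H\<^esub> \<and> x \<otimes>\<^bsub>H\<^esub> x = \<one>\<^bsub>H\<^esub>"

definition central :: "('g, 'm) monoid_scheme \<Rightarrow> 'g \<Rightarrow> bool"
  where "central H x \<longleftrightarrow> x \<in> carrier H \<and> (\<forall>y \<in> carrier H. x \<otimes>\<^bsub>H\<^esub> y = y \<otimes>\<^bsub>H\<^esub> x)"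


section \<open>Standard special groups\<close>

text \<open>
  \<open>(Gal G I r B)\<lparr>carrier := M\<rparr>\<close> is a subgroup \<open>M\<close> regarded as a group in its own right.
\<close>

definition standard :: "('a, 'm) special_group_scheme \<Rightarrow> 'i set \<Rightarrow> 'i rel \<Rightarrow> ('i \<Rightarrow> 'a) \<Rightarrow> bool"
  where "standard G I r B \<longleftrightarrow>
    k_stable G \<and>
    (\<forall>a \<in> carrier G - {\<one>\<^bsub>G\<^esub>}.
       (\<exists>S. clopen_normal (Gal G I r B) (Gal_topology G I r B) S \<and>
            Gal G I r B Mod S \<cong> integer_mod_group 4 \<and>
            S \<subseteq> M_subgroup G I r B a) \<longrightarrow>
       kprod G a a = \<zero>\<^bsub>k_ring G\<^esub>) \<and>
    (\<forall>a \<in> carrier G - {\<one>\<^bsub>G\<^esub>}. \<forall>b \<in> carrier G - {\<one>\<^bsub>G\<^esub>}. a \<noteq> b \<longrightarrow>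
       (\<exists>D. clopen_normal (Gal G I r B) (Gal_topology G I r B) D \<and>
            Gal G I r B Mod D \<cong> dihedral_group 4 \<and>
            D \<subseteq> M_subgroup G I r B a \<inter> M_subgroup G I r B b \<and>
            (Gal G I r B)\<lparr>carrier := M_subgroup G I r B (a \<otimes>\<^bsub>G\<^esub> b)\<rparr> Mod D
              \<cong> integer_mod_group 4) \<longrightarrow>
       kprod G a b = \<zero>\<^bsub>k_ring G\<^esub>)"

end

theory Submission
  imports Defs
begin

text \<open>
  The proof turns involutions of the Galois group into characters of \<open>G\<close>. A vector \<open>\<gamma>\<close> of
  coordinates is the same thing as an additive map \<open>\<gamma> : G \<rightarrow> \<int>/2\<close>. The square of
  \<open>(\<alpha>, \<beta>, \<gamma>)\<close> has the entries \<open>\<gamma>\<^sub>i\<close> and \<open>\<gamma>\<^sub>i\<gamma>\<^sub>j\<close>, so the class of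
  \<open>(\<alpha>, \<beta>, \<gamma>)\<close> has trivial square exactly if these entries annihilate the quadratic relations
  \<open>Q(B)\<close>, that is, if \<open>l(a)l(b) \<mapsto> \<gamma>(a)\<gamma>(b)\<close> is well defined on \<open>k\<^sub>2(G)\<close>. In terms of the
  relations that define \<open>k\<^sub>*(G)\<close> this says \<open>\<gamma>(a)\<gamma>(ab) = 0\<close> for all \<open>a \<in> D(1,b)\<close>.
  A nonzero \<open>\<gamma>\<close> with this property is called a sign character below.

  \<^item> The kernel of a sign character is a proper saturated subgroup of index 2, hence an ordering.
    Conversely every ordering \<open>P\<close> has index 2 and so yields a sign character: for \<open>a \<notin> P\<close> the
    union \<open>P[a]\<close> of the value sets \<open>D(s,ta)\<close> with \<open>s, t \<in> P\<close> is saturated and larger than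
    \<open>P\<close>, hence contains \<open>-1\<close>, and this means \<open>-a \<in> P\<close>. That \<open>P[a]\<close> is a saturated
    subgroup rests on the transitivity of the isometry of ternary forms, used as an associative
    law for \<open>D\<close> (lemma \<open>vals_assoc\<close>).
  \<^item> The Frattini subgroup of the Galois group is the image of \<open>{\<gamma> = 0}\<close> (lemma
    \<open>Frattini_Mod\<close>). So an involution outside of it has \<open>\<gamma> \<noteq> 0\<close> and makes \<open>G\<close> formally
    real, which is (i) \<open>\<Rightarrow>\<close> (ii); and \<open>{\<gamma> = 0}\<close> is central, which is (ii) \<open>\<Rightarrow>\<close> (iii).
  \<^item> For (iii) \<open>\<Rightarrow>\<close> (i) let \<open>\<gamma>\<close> be a sign character. The class of \<open>(0, 0, \<gamma>)\<close> is an
    involution. If it commutes with the class of \<open>(0, 0, \<gamma>')\<close>, then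
    \<open>l(a)l(b) \<mapsto> \<gamma>(a)\<gamma>'(b) + \<gamma>'(a)\<gamma>(b)\<close> is well defined on \<open>k\<^sub>2(G)\<close>. Evaluating it at
    \<open>l(a)l(-a) = 0\<close> and using \<open>\<gamma>(-1) = 1\<close> gives \<open>\<gamma>'(a) = \<gamma>'(-1)\<gamma>(a)\<close>. If this holds for
    all \<open>\<gamma>'\<close>, then the basis has a single element \<open>a\<close>, with \<open>l(a)l(a) \<noteq> 0\<close>, and the Galois
    group has order 2 (lemma \<open>card_le_two_if_involutions_central\<close>).
\<close>

text \<open>
  The default simplification rules for bits replace sums and products by Boolean connectives,
  which destroys the ring structure needed below; they are replaced by
  \<open>a + a = 0\<close> and \<open>a * a = a\<close>.
\<close>

lemma bit_add_self [simp]: "a + a = (0::bit)"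
  by (cases a) simp_all

lemma bit_mult_self [simp]: "a * a = (a::bit)"
  by (cases a) simp_all

lemma bit_add_left_cancel_self [simp]: "a + (a + b) = (b::bit)"
  by (cases a; cases b) simp_all

declare add_bit_eq_xor [simp del] mult_bit_eq_and [simp del]
  bit_not_zero_iff [simp del] bit_not_one_iff [simp del]

section \<open>The free algebra and its evaluations\<close>

lemma finite_word_splits: "finite {(u, v). u @ v = w}"
proof -
  have "(u, v) \<in> (\<lambda>n. (take n w, drop n w)) ` {..length w}" if "u @ v = w" for u v
    using that by (intro image_eqI[where x = "length u"]) auto
  then have "{(u, v). u @ v = w} \<subseteq> (\<lambda>n. (take n w, drop n w)) ` {..length w}"
    by blast
  then show ?thesis
    using finite_subset by blast
qed

lemma free_algebra_simps:
  "p \<in> carrier (free_algebra S) \<longleftrightarrow> finite {w. p w \<noteq> 0} \<and> {w. p w \<noteq> 0} \<subseteq> lists S"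
  "p \<otimes>\<^bsub>free_algebra S\<^esub> q = (\<lambda>w. \<Sum>(u, v) \<in> {(u, v). u @ v = w}. p u * q v)"
  "\<one>\<^bsub>free_algebra S\<^esub> = (\<lambda>w. if w = [] then 1 else 0)"
  "\<zero>\<^bsub>free_algebra S\<^esub> = (\<lambda>w. 0)"
  "p \<oplus>\<^bsub>free_algebra S\<^esub> q = (\<lambda>w. p w + q w)"
  by (simp_all add: free_algebra_def)

lemma convolution_support:
  fixes p q :: "'a list \<Rightarrow> bit"
  shows "{w. (\<Sum>(u, v) \<in> {(u, v). u @ v = w}. p u * q v) \<noteq> 0}
    \<subseteq> (\<lambda>(u, v). u @ v) ` ({w. p w \<noteq> 0} \<times> {w. q w \<noteq> 0})"
proof
  fix w assume "w \<in> {w. (\<Sum>(u, v) \<in> {(u, v). u @ v = w}. p u * q v) \<noteq> 0}"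
  then obtain x where "x \<in> {(u, v). u @ v = w}" "(case x of (u, v) \<Rightarrow> p u * q v) \<noteq> 0"
    using sum.not_neutral_contains_not_neutral by blast
  then show "w \<in> (\<lambda>(u, v). u @ v) ` ({w. p w \<noteq> 0} \<times> {w. q w \<noteq> 0})"
    by (force)
qed

text \<open>
  Both sides are the sum of \<open>p u * q v * s z\<close> over all factorizations \<open>w = u @ v @ z\<close>.
\<close>

lemma convolution_assoc:
  fixes p q s :: "'a list \<Rightarrow> bit"
  shows "(\<Sum>(x, z) \<in> {(x, z). x @ z = w}. (\<Sum>(u, v) \<in> {(u, v). u @ v = x}. p u * q v) * s z)
    = (\<Sum>(u, y) \<in> {(u, y). u @ y = w}. p u * (\<Sum>(v, z) \<in> {(v, z). v @ z = y}. q v * s z))"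
    (is "?L = ?R")
proof -
  let ?D = "\<lambda>w::'a list. {(u, v). u @ v = w}"
  have "?L = (\<Sum>xz \<in> ?D w. \<Sum>uv \<in> ?D (fst xz). p (fst uv) * q (snd uv) * s (snd xz))"
    by (simp add: sum_distrib_right case_prod_unfold)
  also have "\<dots> = (\<Sum>(xz, uv) \<in> Sigma (?D w) (\<lambda>xz. ?D (fst xz)).
      p (fst uv) * q (snd uv) * s (snd xz))"
    by (rule sum.Sigma) (auto simp: finite_word_splits)
  also have "\<dots> = (\<Sum>(uy, vz) \<in> Sigma (?D w) (\<lambda>uy. ?D (snd uy)).
      p (fst uy) * (q (fst vz) * s (snd vz)))"
    by (rule sum.reindex_bij_witness
        [where i = "\<lambda>(uy, vz). ((fst uy @ fst vz, snd vz), (fst uy, fst vz))"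
           and j = "\<lambda>(xz, uv). ((fst uv, snd uv @ snd xz), (snd uv, snd xz))"])
       (auto simp: mult.assoc)
  also have "\<dots> = (\<Sum>uy \<in> ?D w. \<Sum>vz \<in> ?D (snd uy). p (fst uy) * (q (fst vz) * s (snd vz)))"
    by (rule sum.Sigma [symmetric]) (auto simp: finite_word_splits)
  also have "\<dots> = ?R"
    by (simp add: sum_distrib_left case_prod_unfold)
  finally show ?thesis .
qed

lemma free_algebra_closed:
  assumes "p \<in> carrier (free_algebra S)" "q \<in> carrier (free_algebra S)"
  shows "p \<oplus>\<^bsub>free_algebra S\<^esub> q \<in> carrier (free_algebra S)"
    and "p \<otimes>\<^bsub>free_algebra S\<^esub> q \<in> carrier (free_algebra S)"
proof -
  have fin: "finite ({w. p w \<noteq> 0} \<union> {w. q w \<noteq> 0})"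
    using assms by (simp add: free_algebra_simps)
  have "{w. p w + q w \<noteq> 0} \<subseteq> {w. p w \<noteq> 0} \<union> {w. q w \<noteq> 0}"
    by auto
  then show "p \<oplus>\<^bsub>free_algebra S\<^esub> q \<in> carrier (free_algebra S)"
    using assms finite_subset[OF _ fin] unfolding free_algebra_simps by blast
  have fin': "finite ((\<lambda>(u, v). u @ v) ` ({w. p w \<noteq> 0} \<times> {w. q w \<noteq> 0}))"
    using fin by simp
  have "u @ v \<in> lists S" if "p u \<noteq> 0" "q v \<noteq> 0" for u v
  proof -
    have "u \<in> lists S" "v \<in> lists S"
      using assms that unfolding free_algebra_simps by blast+
    then show ?thesis by simp
  qed
  then have "(\<lambda>(u, v). u @ v) ` ({w. p w \<noteq> 0} \<times> {w. q w \<noteq> 0}) \<subseteq> lists S"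
    by (simp add: image_subset_iff)
  then show "p \<otimes>\<^bsub>free_algebra S\<^esub> q \<in> carrier (free_algebra S)"
    using subset_trans[OF convolution_support[of p q]] finite_subset[OF convolution_support[of p q] fin']
    unfolding free_algebra_simps by simp
qed

lemma free_algebra_ring: "ring (free_algebra S)"
proof (rule ringI)
  let ?F = "free_algebra S"
  show "abelian_group ?F"
  proof (rule abelian_groupI)
    fix p assume "p \<in> carrier ?F"
    then show "\<exists>q\<in>carrier ?F. q \<oplus>\<^bsub>?F\<^esub> p = \<zero>\<^bsub>?F\<^esub>"
      by (intro bexI[of _ p]) (simp_all add: free_algebra_simps)
  qed (rule free_algebra_closed(1), assumption+, simp_all add: free_algebra_simps add_ac)
  show "monoid ?F"
  proof (rule monoidI)
    show "\<one>\<^bsub>?F\<^esub> \<in> carrier ?F"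
      by (simp add: free_algebra_simps)
  next
    fix p q s :: "'a list \<Rightarrow> bit"
    show "p \<otimes>\<^bsub>?F\<^esub> q \<otimes>\<^bsub>?F\<^esub> s = p \<otimes>\<^bsub>?F\<^esub> (q \<otimes>\<^bsub>?F\<^esub> s)"
      unfolding free_algebra_simps by (intro ext convolution_assoc)
  next
    fix p :: "'a list \<Rightarrow> bit"
    have "(\<Sum>(u, v) \<in> {(u, v). u @ v = w}. (if u = [] then 1 else 0) * p v)
        = (\<Sum>(u, v) \<in> {([] :: 'a list, w)}. (if u = [] then 1 else 0) * p v)" for w
      by (rule sum.mono_neutral_right) (auto simp: finite_word_splits split: if_splits)
    then show "\<one>\<^bsub>?F\<^esub> \<otimes>\<^bsub>?F\<^esub> p = p"
      unfolding free_algebra_simps by simp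
    have "(\<Sum>(u, v) \<in> {(u, v). u @ v = w}. p u * (if v = [] then 1 else 0))
        = (\<Sum>(u, v) \<in> {(w, [] :: 'a list)}. p u * (if v = [] then 1 else 0))" for w
      by (rule sum.mono_neutral_right) (auto simp: finite_word_splits split: if_splits)
    then show "p \<otimes>\<^bsub>?F\<^esub> \<one>\<^bsub>?F\<^esub> = p"
      unfolding free_algebra_simps by simp
  qed (rule free_algebra_closed(2))
qed (simp_all add: free_algebra_simps(2,5) case_prod_unfold distrib_left distrib_right sum.distrib)

lemma letter_closed: "a \<in> S \<Longrightarrow> letter a \<in> carrier (free_algebra S)"
  by (auto simp: free_algebra_simps letter_def)

text \<open>
  The target of the evaluations, as a ring record. Evaluating in \<open>\<int>/2\<close> instead of
  \<open>\<int>/2[t]\<close> forgets the grading, which is harmless for sums of products \<open>l(a)l(b)\<close>.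
\<close>

definition bit_ring :: "bit ring"
  where "bit_ring = \<lparr>carrier = UNIV, monoid.mult = (*), one = 1, ring.zero = 0, ring.add = (+)\<rparr>"

lemma bit_ring_simps [simp]:
  "carrier bit_ring = UNIV"
  "x \<otimes>\<^bsub>bit_ring\<^esub> y = x * y"
  "\<one>\<^bsub>bit_ring\<^esub> = 1"
  "\<zero>\<^bsub>bit_ring\<^esub> = 0"
  "x \<oplus>\<^bsub>bit_ring\<^esub> y = x + y"
  by (simp_all add: bit_ring_def)

lemma bit_ring_ring: "ring bit_ring"
proof (rule ringI)
  show "abelian_group bit_ring"
  proof (rule abelian_groupI)
    fix p assume "p \<in> carrier bit_ring"
    show "\<exists>q\<in>carrier bit_ring. q \<oplus>\<^bsub>bit_ring\<^esub> p = \<zero>\<^bsub>bit_ring\<^esub>"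
      by (rule bexI[of _ p]) simp_all
  qed (auto simp: add_ac)
  show "monoid bit_ring"
    by (rule monoidI) (auto simp: mult.assoc)
qed (auto simp: distrib_left distrib_right)

definition word_eval :: "('a \<Rightarrow> bit) \<Rightarrow> ('a list \<Rightarrow> bit) \<Rightarrow> bit"
  where "word_eval f p = (\<Sum>w \<in> {w. p w \<noteq> 0}. p w * prod_list (map f w))"

lemma word_eval_superset:
  assumes "finite A" "{w. p w \<noteq> 0} \<subseteq> A"
  shows "word_eval f p = (\<Sum>w \<in> A. p w * prod_list (map f w))"
  unfolding word_eval_def by (rule sum.mono_neutral_left) (use assms in auto)

lemma word_eval_letter [simp]: "word_eval f (letter a) = f a"
proof -
  have "word_eval f (letter a) = (\<Sum>w \<in> {[a]}. letter a w * prod_list (map f w))"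
    by (rule word_eval_superset) (auto simp: letter_def)
  then show ?thesis by (simp add: letter_def)
qed

lemma word_eval_add:
  assumes "p \<in> carrier (free_algebra S)" "q \<in> carrier (free_algebra S)"
  shows "word_eval f (p \<oplus>\<^bsub>free_algebra S\<^esub> q) = word_eval f p + word_eval f q"
proof -
  let ?A = "{w. p w \<noteq> 0} \<union> {w. q w \<noteq> 0}"
  have fin: "finite ?A"
    using assms by (simp add: free_algebra_simps)
  have "word_eval f (p \<oplus>\<^bsub>free_algebra S\<^esub> q)
      = (\<Sum>w \<in> ?A. (p w + q w) * prod_list (map f w))"
    unfolding free_algebra_simps by (rule word_eval_superset[OF fin]) auto
  also have "\<dots> = word_eval f p + word_eval f q"
    using word_eval_superset[OF fin, of p f] word_eval_superset[OF fin, of q f]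
    by (simp add: distrib_right sum.distrib)
  finally show ?thesis .
qed

text \<open>
  The splittings of the words in the support of the product that contribute are exactly the
  pairs of words from the two supports, grouped by their concatenation.
\<close>

lemma word_eval_mult:
  assumes "p \<in> carrier (free_algebra S)" "q \<in> carrier (free_algebra S)"
  shows "word_eval f (p \<otimes>\<^bsub>free_algebra S\<^esub> q) = word_eval f p * word_eval f q"
proof -
  let ?P = "{w. p w \<noteq> 0}" and ?Q = "{w. q w \<noteq> 0}"
  let ?app = "\<lambda>(u, v). u @ v :: 'a list"
  let ?A = "?app ` (?P \<times> ?Q)"
  let ?h = "\<lambda>(u, v). p u * q v * (prod_list (map f u) * prod_list (map f v))"
  have fin: "finite (?P \<times> ?Q)"
    using assms by (simp add: free_algebra_simps)
  have inner: "(\<Sum>(u, v) \<in> {(u, v). u @ v = w}. p u * q v) * prod_list (map f w)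
      = (\<Sum>x \<in> {x \<in> ?P \<times> ?Q. ?app x = w}. ?h x)" for w
  proof -
    have "(\<Sum>(u, v) \<in> {(u, v). u @ v = w}. p u * q v) * prod_list (map f w)
        = (\<Sum>x \<in> {(u, v). u @ v = w}. ?h x)"
      unfolding sum_distrib_right by (rule sum.cong) auto
    also have "\<dots> = (\<Sum>x \<in> {x \<in> ?P \<times> ?Q. ?app x = w}. ?h x)"
      by (rule sum.mono_neutral_right) (auto simp: finite_word_splits split: if_splits)
    finally show ?thesis .
  qed
  have "word_eval f (p \<otimes>\<^bsub>free_algebra S\<^esub> q)
      = (\<Sum>w \<in> ?A. (\<Sum>(u, v) \<in> {(u, v). u @ v = w}. p u * q v) * prod_list (map f w))"
    unfolding free_algebra_simps using fin convolution_support[of p q]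
    by (intro word_eval_superset) auto
  also have "\<dots> = (\<Sum>w \<in> ?A. \<Sum>x \<in> {x \<in> ?P \<times> ?Q. ?app x = w}. ?h x)"
    by (simp only: inner)
  also have "\<dots> = (\<Sum>x \<in> ?P \<times> ?Q. ?h x)"
    by (rule sum.group) (use fin in auto)
  also have "\<dots> = word_eval f p * word_eval f q"
    unfolding word_eval_def sum_product
    by (simp add: sum.cartesian_product mult_ac)
  finally show ?thesis .
qed

lemma word_eval_hom: "word_eval f \<in> ring_hom (free_algebra S) bit_ring"
proof (rule ring_hom_memI)
  have "word_eval f \<one>\<^bsub>free_algebra S\<^esub>
      = (\<Sum>w \<in> {[]}. (if w = [] then 1 else 0) * prod_list (map f w))"
    unfolding free_algebra_simps by (rule word_eval_superset) auto
  then show "word_eval f \<one>\<^bsub>free_algebra S\<^esub> = \<one>\<^bsub>bit_ring\<^esub>"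
    by simp
qed (simp_all add: word_eval_add word_eval_mult)

text \<open>
  Used for both quotients in the construction of the graded ring: a character of \<open>G\<close> is pushed
  from the free algebra to the tensor algebra, and from there to \<open>k\<^sub>*(G)\<close>.
\<close>

lemma quotient_ring_universal:
  assumes "ring R" "ideal J R" "ring S" "h \<in> ring_hom R S" "\<And>x. x \<in> J \<Longrightarrow> h x = \<zero>\<^bsub>S\<^esub>"
  obtains h' where "h' \<in> ring_hom (R Quot J) S" "\<And>x. x \<in> carrier R \<Longrightarrow> h' (J +>\<^bsub>R\<^esub> x) = h x"
proof -
  interpret R: ring R by fact
  interpret J: ideal J R by fact
  interpret S: ring S by fact
  interpret h: ring_hom_ring R S h
    by (intro ring_hom_ringI2) (use assms in auto)
  define h' where "h' A = the_elem (h ` A)" for A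
  have h': "h' (J +>\<^bsub>R\<^esub> x) = h x" if x: "x \<in> carrier R" for x
  proof -
    have "h ` (J +>\<^bsub>R\<^esub> x) = {h x}"
    proof
      show "h ` (J +>\<^bsub>R\<^esub> x) \<subseteq> {h x}"
        using x assms(5) J.Icarr by (auto simp: a_r_coset_def')
      show "{h x} \<subseteq> h ` (J +>\<^bsub>R\<^esub> x)"
        using x J.a_rcos_self by blast
    qed
    then show ?thesis by (simp add: h'_def)
  qed
  have "h' \<in> ring_hom (R Quot J) S"
  proof (rule ring_hom_memI)
    fix A assume "A \<in> carrier (R Quot J)"
    then show "h' A \<in> carrier S"
      using h' by (auto simp: FactRing_simps)
  next
    fix A A' assume "A \<in> carrier (R Quot J)" "A' \<in> carrier (R Quot J)"
    then obtain x y where "x \<in> carrier R" "y \<in> carrier R" "A = J +>\<^bsub>R\<^esub> x" "A' = J +>\<^bsub>R\<^esub> y"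
      by (auto simp: FactRing_simps)
    then show "h' (A \<otimes>\<^bsub>R Quot J\<^esub> A') = h' A \<otimes>\<^bsub>S\<^esub> h' A'"
      and "h' (A \<oplus>\<^bsub>R Quot J\<^esub> A') = h' A \<oplus>\<^bsub>S\<^esub> h' A'"
      using h' by (simp_all add: FactRing_def J.rcoset_mult_add J.a_rcos_sum)
  next
    show "h' \<one>\<^bsub>R Quot J\<^esub> = \<one>\<^bsub>S\<^esub>"
      using h' by (simp add: FactRing_def)
  qed
  with h' that show thesis by blast
qed

lemma hom_vanishes_on_genideal:
  assumes "ring R" "ring S" "h \<in> ring_hom R S" "A \<subseteq> carrier R" "\<And>x. x \<in> A \<Longrightarrow> h x = \<zero>\<^bsub>S\<^esub>"
    and "y \<in> genideal R A"
  shows "h y = \<zero>\<^bsub>S\<^esub>"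
proof -
  have h: "ring_hom_ring R S h"
    using assms(1-3) by (rule ring_hom_ringI2)
  have "A \<subseteq> a_kernel R S h"
    using assms(4,5) by (auto simp: a_kernel_def')
  then have "genideal R A \<subseteq> a_kernel R S h"
    by (rule ring.genideal_minimal[OF assms(1) ring_hom_ring.kernel_is_ideal[OF h]])
  with assms(6) show ?thesis
    by (auto simp: a_kernel_def')
qed

section \<open>The K-theory ring of a special group\<close>

lemma quotient_ring_char_two:
  assumes "ring R" "ideal J R" "\<And>x. x \<in> carrier R \<Longrightarrow> x \<oplus>\<^bsub>R\<^esub> x = \<zero>\<^bsub>R\<^esub>"
    and "A \<in> carrier (R Quot J)"
  shows "A \<oplus>\<^bsub>R Quot J\<^esub> A = \<zero>\<^bsub>R Quot J\<^esub>"
proof -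
  interpret J: ideal J R by fact
  obtain x where x: "x \<in> carrier R" "A = J +>\<^bsub>R\<^esub> x"
    using assms(4) by (auto simp: FactRing_simps)
  interpret h: ring_hom_ring R "R Quot J" "\<lambda>x. J +>\<^bsub>R\<^esub> x"
    by (rule J.rcos_ring_hom_ring)
  show ?thesis
    using x assms(3)[of x] h.hom_add[of x x] h.hom_zero by simp
qed

context pre_special_group
begin

sublocale comm_group G
proof (rule group_comm_groupI)
  fix x y assume xy: "x \<in> carrier G" "y \<in> carrier G"
  have "inv z = z" if "z \<in> carrier G" for z
    using that square_one inv_equality by blast
  then show "x \<otimes> y = y \<otimes> x"
    using xy inv_mult_group[of x y] by simp
qed

lemma repr_closed: "a \<in> repr G b \<Longrightarrow> a \<in> carrier G"
  by (simp add: repr_def)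

text \<open>
  Every element is represented by the hyperbolic form \<open>\<langle>1,-1\<rangle>\<close>, which in
  the K-theory ring becomes \<open>l(a)l(-a) = 0\<close>.
\<close>

lemma repr_mone:
  assumes "a \<in> carrier G"
  shows "a \<in> repr G (mone G)"
  using assms feq_hyperbolic[of a] m_comm[OF assms mone_closed] by (simp add: repr_def neg_def)

lemma add_rels_closed: "add_rels G \<subseteq> carrier (free_algebra (carrier G))"
proof -
  interpret F: ring "free_algebra (carrier G)" by (rule free_algebra_ring)
  show ?thesis
    by (auto simp: add_rels_def Let_def intro!: F.minus_closed F.a_closed letter_closed)
qed

lemma tensor_ideal: "ideal (genideal (free_algebra (carrier G)) (add_rels G)) (free_algebra (carrier G))"
  by (rule ring.genideal_ideal[OF free_algebra_ring add_rels_closed])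

lemma tensor_ring: "ring (tensor_algebra G)"
  unfolding tensor_algebra_def Let_def by (rule ideal.quotient_is_ring[OF tensor_ideal])

lemma tgen_closed: "a \<in> carrier G \<Longrightarrow> tgen G a \<in> carrier (tensor_algebra G)"
  unfolding tensor_algebra_def tgen_def Let_def
  using ring_hom_closed[OF ideal.rcos_ring_hom[OF tensor_ideal] letter_closed] by blast

lemma tgen_mult:
  assumes ab: "a \<in> carrier G" "b \<in> carrier G"
  shows "tgen G (a \<otimes> b) = tgen G a \<oplus>\<^bsub>tensor_algebra G\<^esub> tgen G b"
proof -
  let ?F = "free_algebra (carrier G)"
  let ?J = "genideal ?F (add_rels G)"
  interpret F: ring ?F by (rule free_algebra_ring)
  have "letter (a \<otimes> b) \<ominus>\<^bsub>?F\<^esub> (letter a \<oplus>\<^bsub>?F\<^esub> letter b) \<in> add_rels G"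
    using ab by (auto simp: add_rels_def Let_def)
  then have "letter (a \<otimes> b) \<ominus>\<^bsub>?F\<^esub> (letter a \<oplus>\<^bsub>?F\<^esub> letter b) \<in> ?J"
    using F.genideal_self[OF add_rels_closed] by blast
  then have "?J +>\<^bsub>?F\<^esub> letter (a \<otimes> b) = ?J +>\<^bsub>?F\<^esub> (letter a \<oplus>\<^bsub>?F\<^esub> letter b)"
    using F.quotient_eq_iff_same_a_r_cos[OF tensor_ideal, of "letter (a \<otimes> b)" "letter a \<oplus>\<^bsub>?F\<^esub> letter b"]
    by (simp add: ab letter_closed)
  also have "\<dots> = (?J +>\<^bsub>?F\<^esub> letter a) \<oplus>\<^bsub>?F Quot ?J\<^esub> (?J +>\<^bsub>?F\<^esub> letter b)"
    by (rule ring_hom_add[OF ideal.rcos_ring_hom[OF tensor_ideal]]) (simp_all add: ab letter_closed)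
  finally show ?thesis
    by (simp add: tgen_def tensor_algebra_def Let_def)
qed

lemma tensor_char_two:
  assumes "x \<in> carrier (tensor_algebra G)"
  shows "x \<oplus>\<^bsub>tensor_algebra G\<^esub> x = \<zero>\<^bsub>tensor_algebra G\<^esub>"
  using assms unfolding tensor_algebra_def Let_def
  by (intro quotient_ring_char_two[OF free_algebra_ring tensor_ideal])
     (simp_all add: free_algebra_simps)

lemma k_rels_closed: "k_rels G \<subseteq> carrier (tensor_algebra G)"
proof -
  interpret T: ring "tensor_algebra G" by (rule tensor_ring)
  show ?thesis
    by (auto simp: k_rels_def intro!: T.m_closed tgen_closed dest: repr_closed)
qed

lemma k_ideal: "ideal (genideal (tensor_algebra G) (k_rels G)) (tensor_algebra G)"
  by (rule ring.genideal_ideal[OF tensor_ring k_rels_closed])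

lemma k_ring_ring: "ring (k_ring G)"
  unfolding k_ring_def by (rule ideal.quotient_is_ring[OF k_ideal])

lemma k_char_two: "x \<in> carrier (k_ring G) \<Longrightarrow> x \<oplus>\<^bsub>k_ring G\<^esub> x = \<zero>\<^bsub>k_ring G\<^esub>"
  unfolding k_ring_def by (rule quotient_ring_char_two[OF tensor_ring k_ideal tensor_char_two])

lemma k_projection_hom:
  "(\<lambda>x. genideal (tensor_algebra G) (k_rels G) +>\<^bsub>tensor_algebra G\<^esub> x)
    \<in> ring_hom (tensor_algebra G) (k_ring G)"
  unfolding k_ring_def using ideal.rcos_ring_hom[OF k_ideal] .

lemma kl_closed: "a \<in> carrier G \<Longrightarrow> kl G a \<in> carrier (k_ring G)"
  unfolding kl_def by (rule ring_hom_closed[OF k_projection_hom tgen_closed])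

lemma kl_mult:
  assumes "a \<in> carrier G" "b \<in> carrier G"
  shows "kl G (a \<otimes> b) = kl G a \<oplus>\<^bsub>k_ring G\<^esub> kl G b"
  unfolding kl_def tgen_mult[OF assms]
  by (rule ring_hom_add[OF k_projection_hom]) (simp_all add: assms tgen_closed)

lemma kprod_closed: "a \<in> carrier G \<Longrightarrow> b \<in> carrier G \<Longrightarrow> kprod G a b \<in> carrier (k_ring G)"
  unfolding kprod_def by (intro monoid.m_closed ring.is_monoid k_ring_ring kl_closed)

lemma kprod_mult_left:
  assumes "a \<in> carrier G" "b \<in> carrier G" "c \<in> carrier G"
  shows "kprod G (a \<otimes> b) c = kprod G a c \<oplus>\<^bsub>k_ring G\<^esub> kprod G b c"
proof -
  interpret K: ring "k_ring G" by (rule k_ring_ring)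
  show ?thesis
    using assms by (simp add: kprod_def kl_mult K.l_distr kl_closed)
qed

lemma kprod_mult_right:
  assumes "a \<in> carrier G" "b \<in> carrier G" "c \<in> carrier G"
  shows "kprod G a (b \<otimes> c) = kprod G a b \<oplus>\<^bsub>k_ring G\<^esub> kprod G a c"
proof -
  interpret K: ring "k_ring G" by (rule k_ring_ring)
  show ?thesis
    using assms by (simp add: kprod_def kl_mult K.r_distr kl_closed)
qed

lemma kprod_one:
  assumes "a \<in> carrier G"
  shows "kprod G \<one> a = \<zero>\<^bsub>k_ring G\<^esub>" "kprod G a \<one> = \<zero>\<^bsub>k_ring G\<^esub>"
  using assms kprod_mult_left[of \<one> \<one> a] kprod_mult_right[of a \<one> \<one>]
  by (simp_all add: k_char_two kprod_closed)

lemma kprod_relation: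
  assumes "b \<in> carrier G" "a \<in> repr G b"
  shows "kprod G a (a \<otimes> b) = \<zero>\<^bsub>k_ring G\<^esub>"
proof -
  let ?T = "tensor_algebra G"
  let ?J = "genideal ?T (k_rels G)"
  interpret T: ring ?T by (rule tensor_ring)
  interpret J: ideal ?J ?T by (rule k_ideal)
  have a: "a \<in> carrier G" using assms by (simp add: repr_closed)
  have "tgen G a \<otimes>\<^bsub>?T\<^esub> tgen G (a \<otimes> b) \<in> k_rels G"
    using assms by (auto simp: k_rels_def)
  then have mem: "tgen G a \<otimes>\<^bsub>?T\<^esub> tgen G (a \<otimes> b) \<in> ?J"
    using T.genideal_self[OF k_rels_closed] by blast
  have "kprod G a (a \<otimes> b) = ?J +>\<^bsub>?T\<^esub> (tgen G a \<otimes>\<^bsub>?T\<^esub> tgen G (a \<otimes> b))"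
    unfolding kprod_def kl_def
    using a assms by (intro ring_hom_mult[OF k_projection_hom, symmetric] tgen_closed) auto
  also have "\<dots> = ?J"
    by (rule T.a_rcos_zero[OF k_ideal mem])
  finally show ?thesis
    by (simp add: k_ring_def FactRing_def)
qed

lemma kprod_neg: "a \<in> carrier G \<Longrightarrow> kprod G a (neg G a) = \<zero>\<^bsub>k_ring G\<^esub>"
  using kprod_relation[OF mone_closed repr_mone, of a] by (simp add: neg_def m_comm mone_closed)

text \<open>
  Expanding \<open>l(ab)l(-ab) = 0\<close> and cancelling \<open>l(a)l(-a)\<close> and \<open>l(b)l(-b)\<close> leaves
  \<open>l(a)l(b) + l(b)l(a) = 0\<close>.
\<close>

lemma kprod_commute:
  assumes ab: "a \<in> carrier G" "b \<in> carrier G"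
  shows "kprod G a b = kprod G b a"
proof -
  interpret K: ring "k_ring G" by (rule k_ring_ring)
  have n: "neg G x \<in> carrier G" if "x \<in> carrier G" for x
    using that mone_closed by (simp add: neg_def)
  have "\<zero>\<^bsub>k_ring G\<^esub> = kprod G (a \<otimes> b) (neg G (a \<otimes> b))"
    using ab by (simp add: kprod_neg)
  also have "\<dots> = kprod G a (neg G (a \<otimes> b)) \<oplus>\<^bsub>k_ring G\<^esub> kprod G b (neg G (a \<otimes> b))"
    using ab n by (simp add: kprod_mult_left)
  also have "neg G (a \<otimes> b) = neg G a \<otimes> b"
    using ab by (simp add: neg_def mone_closed m_assoc)
  also have "kprod G a (neg G a \<otimes> b) = kprod G a b"
    using ab n by (simp add: kprod_mult_right kprod_neg kprod_closed)
  also have "neg G a \<otimes> b = neg G b \<otimes> a"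
    using ab by (simp add: neg_def mone_closed m_ac)
  also have "kprod G b (neg G b \<otimes> a) = kprod G b a"
    using ab n by (simp add: kprod_mult_right kprod_neg kprod_closed)
  finally have "kprod G a b \<oplus>\<^bsub>k_ring G\<^esub> kprod G b a = \<zero>\<^bsub>k_ring G\<^esub>" by simp
  moreover have "kprod G b a \<oplus>\<^bsub>k_ring G\<^esub> kprod G b a = \<zero>\<^bsub>k_ring G\<^esub>"
    using ab by (simp add: k_char_two kprod_closed)
  ultimately show ?thesis
    using ab kprod_closed K.add.right_cancel by metis
qed

text \<open>
  The evaluation of words at \<open>f\<close> kills the additive relations because \<open>f\<close> is additive, and the
  remaining relations by the second hypothesis.
\<close>

lemma k_ring_evaluation:
  assumes mult: "\<And>a b. a \<in> carrier G \<Longrightarrow> b \<in> carrier G \<Longrightarrow> f (a \<otimes> b) = f a + (f b :: bit)"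
    and rel: "\<And>a b. b \<in> carrier G \<Longrightarrow> a \<in> repr G b \<Longrightarrow> f a * f (a \<otimes> b) = 0"
  obtains h where "h \<in> ring_hom (k_ring G) bit_ring"
    "\<And>a b. a \<in> carrier G \<Longrightarrow> b \<in> carrier G \<Longrightarrow> h (kprod G a b) = f a * f b"
proof -
  let ?F = "free_algebra (carrier G)"
  let ?T = "tensor_algebra G"
  interpret F: ring ?F by (rule free_algebra_ring)
  have minus: "letter (a \<otimes> b) \<ominus>\<^bsub>?F\<^esub> (letter a \<oplus>\<^bsub>?F\<^esub> letter b)
      = letter (a \<otimes> b) \<oplus>\<^bsub>?F\<^esub> (letter a \<oplus>\<^bsub>?F\<^esub> letter b)"
    if "a \<in> carrier G" "b \<in> carrier G" for a b
  proof -
    let ?s = "letter a \<oplus>\<^bsub>?F\<^esub> letter b"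
    have "?s \<in> carrier ?F" using that by (simp add: letter_closed)
    moreover have "?s \<oplus>\<^bsub>?F\<^esub> ?s = \<zero>\<^bsub>?F\<^esub>" by (simp add: free_algebra_simps)
    ultimately have "\<ominus>\<^bsub>?F\<^esub> ?s = ?s" using F.minus_equality by blast
    then show ?thesis by (simp add: a_minus_def)
  qed
  have "word_eval f x = \<zero>\<^bsub>bit_ring\<^esub>" if "x \<in> add_rels G" for x
    using that minus mult
    by (auto simp: add_rels_def Let_def word_eval_add[where S = "carrier G"] letter_closed)
  then have "word_eval f x = \<zero>\<^bsub>bit_ring\<^esub>" if "x \<in> genideal ?F (add_rels G)" for x
    using that hom_vanishes_on_genideal[OF free_algebra_ring bit_ring_ring word_eval_hom add_rels_closed]
    by blast
  then obtain g where g: "g \<in> ring_hom ?T bit_ring"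
    and g_tgen: "\<And>a. a \<in> carrier G \<Longrightarrow> g (tgen G a) = f a"
    using quotient_ring_universal[OF free_algebra_ring tensor_ideal bit_ring_ring word_eval_hom]
    unfolding tensor_algebra_def tgen_def Let_def
    by (metis letter_closed word_eval_letter)
  have "g x = \<zero>\<^bsub>bit_ring\<^esub>" if "x \<in> k_rels G" for x
    using that rel
    by (auto simp: k_rels_def ring_hom_mult[OF g] tgen_closed g_tgen repr_closed)
  then have "g x = \<zero>\<^bsub>bit_ring\<^esub>" if "x \<in> genideal ?T (k_rels G)" for x
    using that hom_vanishes_on_genideal[OF tensor_ring bit_ring_ring g k_rels_closed] by blast
  then obtain h where h: "h \<in> ring_hom (k_ring G) bit_ring"
    and h_kl: "\<And>a. a \<in> carrier G \<Longrightarrow> h (kl G a) = f a"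
    using quotient_ring_universal[OF tensor_ring k_ideal bit_ring_ring g]
    unfolding k_ring_def kl_def by (metis g_tgen tgen_closed)
  have "h (kprod G a b) = f a * f b" if "a \<in> carrier G" "b \<in> carrier G" for a b
    using that by (simp add: kprod_def ring_hom_mult[OF h] kl_closed h_kl)
  with h that show thesis by blast
qed

section \<open>Value sets and orderings\<close>

text \<open>
  The value set \<open>D(a,b)\<close> of a binary form. It is convenient to think of it as a many-valued
  sum of \<open>a\<close> and \<open>b\<close>, which is commutative and, in a special group, associative; scaling is
  distributive over it.
\<close>

definition vals :: "'a \<Rightarrow> 'a \<Rightarrow> 'a set"
  where "vals a b = {x \<in> carrier G. ((x, x \<otimes> a \<otimes> b), (a, b)) \<in> feq G}"

lemma feq_closed:
  assumes "((a, b), (c, d)) \<in> feq G"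
  shows "a \<in> carrier G" "b \<in> carrier G" "c \<in> carrier G" "d \<in> carrier G"
  using assms feq_equiv by (auto simp: equiv_def refl_on_def)

lemma feq_sym: "((a, b), (c, d)) \<in> feq G \<Longrightarrow> ((c, d), (a, b)) \<in> feq G"
  using feq_equiv by (meson equivE symE)

lemma feq_refl: "a \<in> carrier G \<Longrightarrow> b \<in> carrier G \<Longrightarrow> ((a, b), (a, b)) \<in> feq G"
  using feq_equiv by (meson SigmaI equivE refl_onD)

lemma feq_trans:
  "((a, b), (c, d)) \<in> feq G \<Longrightarrow> ((c, d), (e, f)) \<in> feq G \<Longrightarrow> ((a, b), (e, f)) \<in> feq G"
  using feq_equiv by (meson equivE transE)

lemma square_cancel: "a \<in> carrier G \<Longrightarrow> b \<in> carrier G \<Longrightarrow> a \<otimes> (a \<otimes> b) = b"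
  using square_one[of a] m_assoc[of a a b] by simp

lemma feq_snd:
  assumes "((a, b), (c, d)) \<in> feq G"
  shows "b = a \<otimes> c \<otimes> d"
  using feq_discriminant[OF assms] feq_closed[OF assms] square_cancel by (metis m_assoc)

lemma valsI: "((x, y), (a, b)) \<in> feq G \<Longrightarrow> x \<in> vals a b"
  using feq_snd[of x y a b] feq_closed[of x y a b] by (auto simp: vals_def)

lemma repr_eq_vals: "a \<in> carrier G \<Longrightarrow> repr G a = vals \<one> a"
  by (auto simp: repr_def vals_def)

lemma vals_closed: "x \<in> vals a b \<Longrightarrow> x \<in> carrier G"
  by (simp add: vals_def)

lemma vals_commute: "a \<in> carrier G \<Longrightarrow> b \<in> carrier G \<Longrightarrow> vals a b = vals b a"
proof -
  have "x \<in> vals b a" if "a \<in> carrier G" "b \<in> carrier G" "x \<in> vals a b" for x a b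
    using that feq_trans[OF _ feq_commute[of a b]] valsI unfolding vals_def by blast
  then show "a \<in> carrier G \<Longrightarrow> b \<in> carrier G \<Longrightarrow> vals a b = vals b a" by blast
qed

lemma left_mem_vals: "a \<in> carrier G \<Longrightarrow> b \<in> carrier G \<Longrightarrow> a \<in> vals a b"
  using feq_refl valsI by blast

lemma right_mem_vals: "a \<in> carrier G \<Longrightarrow> b \<in> carrier G \<Longrightarrow> b \<in> vals a b"
  using feq_commute valsI by blast

lemma vals_scale:
  assumes "x \<in> vals a b" "g \<in> carrier G"
  shows "g \<otimes> x \<in> vals (g \<otimes> a) (g \<otimes> b)"
  using assms feq_scale valsI unfolding vals_def by blast

lemma feq3I:
  assumes "((a1, x), (b1, y)) \<in> feq G" "((a2, a3), (x, z)) \<in> feq G" "((b2, b3), (y, z)) \<in> feq G"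
  shows "((a1, a2, a3), (b1, b2, b3)) \<in> feq3 G"
  using assms feq_closed[OF assms(1)] feq_closed[OF assms(2)] feq_closed[OF assms(3)]
  by (auto simp: feq3_def)

lemma feq3E:
  assumes "((a1, a2, a3), (b1, b2, b3)) \<in> feq3 G"
  obtains x y z where "((a1, x), (b1, y)) \<in> feq G" "((a2, a3), (x, z)) \<in> feq G"
    "((b2, b3), (y, z)) \<in> feq G"
  using assms by (auto simp: feq3_def)

lemma saturated_vals:
  assumes "saturated G P" "s \<in> P" "t \<in> P"
  shows "vals s t \<subseteq> P"
proof
  fix x assume x: "x \<in> vals s t"
  interpret P: subgroup P G using assms(1) by (simp add: saturated_def)
  have "s \<otimes> x \<in> repr G (s \<otimes> t)"
    using vals_scale[OF x, of s] assms(2,3) by (simp add: repr_eq_vals square_one)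
  then have "s \<otimes> x \<in> P"
    using assms by (auto simp: saturated_def)
  then have "s \<otimes> (s \<otimes> x) \<in> P"
    using assms(2) by blast
  then show "x \<in> P"
    using assms(2) x by (simp add: square_cancel vals_closed)
qed

text \<open>
  The second clause says that \<open>l(a)l(b) \<mapsto> f(a)f(b)\<close> respects the defining relations of
  \<open>k\<^sub>2(G)\<close>.
\<close>

definition sign_character :: "('a \<Rightarrow> bit) \<Rightarrow> bool"
  where "sign_character f \<longleftrightarrow>
    (\<forall>a \<in> carrier G. \<forall>b \<in> carrier G. f (a \<otimes> b) = f a + f b) \<and>
    (\<forall>b \<in> carrier G. \<forall>a \<in> repr G b. f a * f (a \<otimes> b) = 0) \<and>
    (\<exists>a \<in> carrier G. f a \<noteq> 0)"

text \<open>
  Otherwise \<open>f(a) = f(a)f(-a)\<close> would vanish identically, since \<open>a\<close> is represented by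
  \<open>\<langle>1,-1\<rangle>\<close>.
\<close>

lemma sign_character_mone:
  assumes "sign_character f"
  shows "f (mone G) = 1"
proof -
  obtain a where a: "a \<in> carrier G" "f a \<noteq> 0"
    using assms by (auto simp: sign_character_def)
  have "f a * (f a + f (mone G)) = 0"
    using assms a(1) repr_mone[OF a(1)] mone_closed unfolding sign_character_def by metis
  with a(2) show ?thesis
    by (cases "f a"; cases "f (mone G)") simp_all
qed

text \<open>
  The kernel of \<open>f\<close> is saturated, because \<open>f(a)f(ab) = f(a)\<close> if \<open>f(b) = 0\<close>. It has index 2,
  so no proper subgroup is larger.
\<close>

lemma sign_character_imp_formally_real:
  assumes f: "sign_character f"
  shows "formally_real G"
proof -
  define P where "P = {a \<in> carrier G. f a = 0}"
  have mult: "f (a \<otimes> b) = f a + f b" if "a \<in> carrier G" "b \<in> carrier G" for a b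
    using f that by (simp add: sign_character_def)
  have f_one: "f \<one> = 0" using mult[of \<one> \<one>] by simp
  have inv: "inv a = a" if "a \<in> carrier G" for a
    using that square_one inv_equality by blast
  have "subgroup P G"
    by (rule subgroupI) (use mult f_one inv in \<open>auto simp: P_def\<close>)
  moreover have "repr G b \<subseteq> P" if b: "b \<in> P" for b
  proof
    fix a assume a: "a \<in> repr G b"
    then have "f a * (f a + f b) = 0"
      using f b a mult unfolding sign_character_def P_def by (metis (no_types, lifting) mem_Collect_eq repr_closed)
    then show "a \<in> P"
      using b repr_closed[OF a] by (simp add: P_def)
  qed
  ultimately have sat: "saturated G P" by (simp add: saturated_def)
  have "P \<noteq> carrier G"
    using f by (auto simp: sign_character_def P_def)
  moreover have "D = P" if D: "saturated G D" "D \<noteq> carrier G" "P \<subseteq> D" for D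
  proof (rule ccontr)
    assume "D \<noteq> P"
    then obtain x where x: "x \<in> D" "x \<notin> P" using D(3) by blast
    interpret D: subgroup D G using D(1) by (simp add: saturated_def)
    have "y \<in> D" if y: "y \<in> carrier G" for y
    proof (cases "y \<in> P")
      case False
      then have "f y = 1" "f x = 1"
        using x y by (auto simp: P_def bit_not_zero_iff)
      then have "y \<otimes> x \<in> P"
        using x y mult by (auto simp: P_def)
      then have "x \<otimes> (y \<otimes> x) \<in> D" using D(3) x(1) by blast
      then show ?thesis using x y by (simp add: m_comm square_cancel)
    qed (use D in blast)
    then show False using D(2) D.subset by blast
  qed
  ultimately show ?thesis
    using sat unfolding formally_real_def sg_ordering_def by blast
qed

end

context special_group
begin

text \<open>
  Associativity of the many-valued sum. From \<open>z \<in> D(b,c)\<close> and \<open>x \<in> D(a,z)\<close> one obtains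
  an isometry of \<open>\<langle>a,b,c\<rangle>\<close> with a form whose first entry is \<open>x\<close>. Composing it with the
  permutation \<open>\<langle>c,a,b\<rangle> \<equiv> \<langle>a,b,c\<rangle>\<close> and reading off the definition of ternary isometry gives an
  element of \<open>D(a,b)\<close> whose sum with \<open>c\<close> contains \<open>x\<close>.
\<close>

lemma vals_assoc:
  assumes abc: "a \<in> carrier G" "b \<in> carrier G" "c \<in> carrier G"
    and z: "z \<in> vals b c" and x: "x \<in> vals a z"
  obtains z' where "z' \<in> vals a b" "x \<in> vals z' c"
proof -
  have zx: "z \<in> carrier G" "x \<in> carrier G"
    using z x by (simp_all add: vals_def)
  have "((c, a, b), (a, b, c)) \<in> feq3 G"
    using abc by (intro feq3I[of c a a c _ _ b] feq_commute feq_refl)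
  moreover have "((a, b, c), (x, x \<otimes> a \<otimes> z, z \<otimes> b \<otimes> c)) \<in> feq3 G"
  proof -
    have "((a, z), (x, x \<otimes> a \<otimes> z)) \<in> feq G" "((b, c), (z, z \<otimes> b \<otimes> c)) \<in> feq G"
      using x z feq_sym by (simp_all add: vals_def)
    moreover have "((x \<otimes> a \<otimes> z, z \<otimes> b \<otimes> c), (x \<otimes> a \<otimes> z, z \<otimes> b \<otimes> c)) \<in> feq G"
      using abc zx by (simp add: feq_refl)
    ultimately show ?thesis
      by (rule feq3I)
  qed
  ultimately have "((c, a, b), (x, x \<otimes> a \<otimes> z, z \<otimes> b \<otimes> c)) \<in> feq3 G"
    using feq3_trans by (meson transE)
  then obtain u v w where cu: "((c, u), (x, v)) \<in> feq G" and ab: "((a, b), (u, w)) \<in> feq G"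
    by (rule feq3E)
  have "u \<in> vals a b"
    using feq_sym[OF ab] by (rule valsI)
  moreover have "x \<in> vals u c"
    using valsI[OF feq_sym[OF cu]] vals_commute[of c u] feq_closed[OF cu] by simp
  ultimately
  show thesis by (rule that)
qed

text \<open>
  The rearrangement \<open>(a + b) + (c + d) = (a + c) + (b + d)\<close> of many-valued sums.
\<close>

lemma vals_interchange:
  assumes abcd: "a \<in> carrier G" "b \<in> carrier G" "c \<in> carrier G" "d \<in> carrier G"
    and "p \<in> vals a b" "q \<in> vals c d" "x \<in> vals p q"
  obtains p' q' where "p' \<in> vals a c" "q' \<in> vals b d" "x \<in> vals p' q'"
proof -
  have pq: "p \<in> carrier G" "q \<in> carrier G"
    using assms vals_closed by blast+
  then have "x \<in> vals q p" using assms vals_commute by blast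
  then obtain z where z: "z \<in> vals q a" "x \<in> vals z b"
    using vals_assoc abcd assms pq by metis
  then have "z \<in> vals a q" and zc: "z \<in> carrier G"
    using vals_commute vals_closed abcd pq by blast+
  then obtain p' where p': "p' \<in> vals a c" "z \<in> vals p' d"
    using vals_assoc abcd assms by metis
  have p'c: "p' \<in> carrier G" using p' vals_closed by blast
  have "x \<in> vals b z" "z \<in> vals d p'"
    using z p' zc p'c vals_commute abcd by blast+
  then obtain q' where q': "q' \<in> vals b d" "x \<in> vals q' p'"
    using vals_assoc abcd p'c by metis
  have "x \<in> vals p' q'"
    using q' p'c vals_closed vals_commute by blast
  with p' q' that show thesis by blast
qed

text \<open>
  The analogue of the preordering \<open>P + aP\<close> of a field.
\<close>

definition adjoin :: "'a set \<Rightarrow> 'a \<Rightarrow> 'a set"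
  where "adjoin P a = (\<Union>s \<in> P. \<Union>t \<in> P. vals s (t \<otimes> a))"

lemma adjoinI: "s \<in> P \<Longrightarrow> t \<in> P \<Longrightarrow> x \<in> vals s (t \<otimes> a) \<Longrightarrow> x \<in> adjoin P a"
  by (auto simp: adjoin_def)

text \<open>
  Closure under products is the only serious point. For \<open>x \<in> D(s,ta)\<close> and
  \<open>y \<in> D(s',t'a)\<close> the product \<open>xy\<close> lies in the four-fold sum of \<open>ss'\<close>, \<open>s'ta\<close>, \<open>tt'\<close>
  and \<open>t'sa\<close>. Interchanging the summands turns this into \<open>p + q\<close> with \<open>p \<in> D(ss',tt')\<close> and
  \<open>q \<in> aD(s't,t's)\<close>, where both value sets are contained in \<open>P\<close>.
\<close>

lemma adjoin_saturated:
  assumes P: "saturated G P" and a: "a \<in> carrier G"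
  shows "saturated G (adjoin P a)"
proof -
  interpret P: subgroup P G using P by (simp add: saturated_def)
  have inv: "inv x = x" if "x \<in> carrier G" for x
    using that square_one inv_equality by blast
  have sub: "adjoin P a \<subseteq> carrier G"
    by (auto simp: adjoin_def vals_closed)
  have "x \<otimes> y \<in> adjoin P a" if xy: "x \<in> adjoin P a" "y \<in> adjoin P a" for x y
  proof -
    obtain s t where st: "s \<in> P" "t \<in> P" and x: "x \<in> vals s (t \<otimes> a)"
      using xy by (auto simp: adjoin_def)
    obtain s' t' where st': "s' \<in> P" "t' \<in> P" and y: "y \<in> vals s' (t' \<otimes> a)"
      using xy by (auto simp: adjoin_def)
    have carr: "s \<in> carrier G" "t \<in> carrier G" "s' \<in> carrier G" "t' \<in> carrier G"
      "x \<in> carrier G" "y \<in> carrier G"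
      using st st' x y vals_closed by auto
    have "x \<otimes> y \<in> vals (s' \<otimes> x) (t' \<otimes> a \<otimes> x)"
      using vals_scale[OF y, of x] carr a by (simp add: m_ac)
    moreover have "s' \<otimes> x \<in> vals (s' \<otimes> s) (s' \<otimes> t \<otimes> a)"
      using vals_scale[OF x, of s'] carr a by (simp add: m_ac)
    moreover have "t' \<otimes> a \<otimes> x \<in> vals (t' \<otimes> t) (t' \<otimes> s \<otimes> a)"
    proof -
      have "t' \<otimes> a \<otimes> x \<in> vals (t' \<otimes> a \<otimes> s) (t' \<otimes> a \<otimes> (t \<otimes> a))"
        using vals_scale[OF x, of "t' \<otimes> a"] carr a by simp
      moreover have "t' \<otimes> a \<otimes> (t \<otimes> a) = t' \<otimes> t"
        using carr a by (simp add: m_ac square_cancel square_one)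
      ultimately show ?thesis
        using carr a vals_commute[of "t' \<otimes> a \<otimes> s" "t' \<otimes> t"] by (simp add: m_ac)
    qed
    ultimately obtain p q where p: "p \<in> vals (s' \<otimes> s) (t' \<otimes> t)"
      and q: "q \<in> vals (s' \<otimes> t \<otimes> a) (t' \<otimes> s \<otimes> a)" and pq: "x \<otimes> y \<in> vals p q"
      using carr a vals_interchange[of "s' \<otimes> s" "s' \<otimes> t \<otimes> a" "t' \<otimes> t" "t' \<otimes> s \<otimes> a"]
      by (metis m_closed)
    have "p \<in> P"
      using p saturated_vals[OF P, of "s' \<otimes> s" "t' \<otimes> t"] st st' by blast
    moreover have "q \<otimes> a \<in> P"
    proof -
      have "a \<otimes> q \<in> vals (s' \<otimes> t) (t' \<otimes> s)"
        using vals_scale[OF q a] carr a by (simp add: m_ac square_cancel square_one)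
      then show ?thesis
        using saturated_vals[OF P, of "s' \<otimes> t" "t' \<otimes> s"] st st' q a
        by (auto simp: m_comm vals_closed)
    qed
    moreover have "q = q \<otimes> a \<otimes> a"
      using q a by (simp add: m_assoc square_one vals_closed)
    ultimately have "p \<in> P" "q \<otimes> a \<in> P" "x \<otimes> y \<in> vals p (q \<otimes> a \<otimes> a)"
      using pq by simp_all
    then show ?thesis by (rule adjoinI)
  qed
  moreover have "\<one> \<in> adjoin P a"
    using a by (intro adjoinI[of \<one> P \<one>] left_mem_vals) simp_all
  ultimately have "subgroup (adjoin P a) G"
    using sub inv by (intro subgroupI) auto
  moreover have "repr G x \<subseteq> adjoin P a" if x_in: "x \<in> adjoin P a" for x
  proof
    fix y assume "y \<in> repr G x"
    obtain s t where st: "s \<in> P" "t \<in> P" and x: "x \<in> vals s (t \<otimes> a)"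
      using x_in by (auto simp: adjoin_def)
    have "y \<in> vals \<one> x"
      using \<open>y \<in> repr G x\<close> x by (simp add: repr_eq_vals vals_closed)
    then obtain z where z: "z \<in> vals \<one> s" "y \<in> vals z (t \<otimes> a)"
      using vals_assoc[of \<one> s "t \<otimes> a" x y] x st a by auto
    then have "z \<in> P"
      using saturated_vals[OF P P.one_closed st(1)] by blast
    then show "y \<in> adjoin P a"
      using z(2) st(2) by (intro adjoinI)
  qed
  ultimately show ?thesis by (simp add: saturated_def)
qed

text \<open>
  Exchange in \<open>\<langle>-1,-sta\<rangle> \<equiv> \<langle>s,ta\<rangle>\<close> moves \<open>s\<close> and \<open>ta\<close> to opposite sides and shows
  \<open>-ta \<in> D(1,s)\<close>, a subset of \<open>P\<close>.
\<close>

lemma mone_mem_adjoin: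
  assumes P: "saturated G P" and a: "a \<in> carrier G" and m: "mone G \<in> adjoin P a"
  shows "neg G a \<in> P"
proof -
  interpret P: subgroup P G using P by (simp add: saturated_def)
  obtain s t where st: "s \<in> P" "t \<in> P" and ms: "mone G \<in> vals s (t \<otimes> a)"
    using m by (auto simp: adjoin_def)
  define u where "u = neg G (mone G \<otimes> s \<otimes> (t \<otimes> a))"
  have "((mone G, mone G \<otimes> s), (u, t \<otimes> a)) \<in> feq G"
    using ms feq_exchange unfolding vals_def u_def neg_def by blast
  from feq_scale[OF this mone_closed]
  have "((\<one>, s), (mone G \<otimes> u, mone G \<otimes> (t \<otimes> a))) \<in> feq G"
    using st by (simp add: square_one square_cancel mone_closed)
  then have flip: "((mone G \<otimes> u, mone G \<otimes> (t \<otimes> a)), (\<one>, s)) \<in> feq G"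
    by (rule feq_sym)
  have "((mone G \<otimes> (t \<otimes> a), mone G \<otimes> u), (\<one>, s)) \<in> feq G"
    by (rule feq_trans[OF feq_commute flip]) (use feq_closed[OF flip] in auto)
  then have "mone G \<otimes> (t \<otimes> a) \<in> P"
    using valsI saturated_vals[OF P P.one_closed st(1)] by blast
  then have "t \<otimes> (mone G \<otimes> (t \<otimes> a)) \<in> P"
    using st by blast
  also have "t \<otimes> (mone G \<otimes> (t \<otimes> a)) = neg G a"
  proof -
    have t: "t \<in> carrier G" using st P.subset by blast
    have "t \<otimes> (mone G \<otimes> (t \<otimes> a)) = t \<otimes> (t \<otimes> (mone G \<otimes> a))"
      using t a mone_closed by (simp add: m_lcomm)
    then show ?thesis
      using t a mone_closed by (simp add: neg_def square_cancel)
  qed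
  finally show ?thesis .
qed

text \<open>
  By maximality of \<open>P\<close> the saturated subgroup generated by \<open>P\<close> and \<open>a\<close> is all of \<open>G\<close>, hence
  contains \<open>-1\<close>.
\<close>

lemma ordering_index_two:
  assumes P: "sg_ordering G P" and a: "a \<in> carrier G" "a \<notin> P"
  shows "neg G a \<in> P"
proof -
  have sat: "saturated G P" using P by (simp add: sg_ordering_def)
  interpret P: subgroup P G using sat by (simp add: saturated_def)
  have "P \<subseteq> adjoin P a"
    using a(1) by (auto intro!: adjoinI[of _ P \<one>] left_mem_vals)
  moreover have "a \<in> adjoin P a"
    using right_mem_vals[of \<one> "\<one> \<otimes> a"] a(1) by (intro adjoinI[of \<one> P \<one>]) simp_all
  ultimately have "adjoin P a = carrier G"
    using P adjoin_saturated[OF sat a(1)] a(2) unfolding sg_ordering_def by blast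
  then show ?thesis
    using mone_mem_adjoin[OF sat a(1)] mone_closed by blast
qed

text \<open>
  The sign character of an ordering \<open>P\<close> is the quotient map modulo \<open>P\<close>, which takes values in
  \<open>\<int>/2\<close> because the index is 2.
\<close>

lemma formally_real_imp_sign_character:
  assumes "formally_real G"
  obtains f where "sign_character f"
proof -
  obtain P where P: "sg_ordering G P"
    using assms by (auto simp: formally_real_def)
  then have sat: "saturated G P" and proper: "P \<noteq> carrier G"
    by (simp_all add: sg_ordering_def)
  interpret P: subgroup P G using sat by (simp add: saturated_def)
  have cancel: "b \<in> P" if "a \<in> P" "b \<in> carrier G" "a \<otimes> b \<in> P" for a b
    using that P.m_closed[of a "a \<otimes> b"] by (simp add: square_cancel)
  have both: "a \<otimes> b \<in> P" if ab: "a \<in> carrier G" "b \<in> carrier G" "a \<notin> P" "b \<notin> P" for a b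
  proof -
    have "neg G a \<otimes> neg G b \<in> P"
      using ordering_index_two[OF P] ab by blast
    moreover have "neg G a \<otimes> neg G b = mone G \<otimes> (mone G \<otimes> (a \<otimes> b))"
      using ab mone_closed by (simp add: neg_def m_ac)
    ultimately show ?thesis
      using ab mone_closed by (simp add: square_cancel)
  qed
  define f :: "'a \<Rightarrow> bit" where "f a = (if a \<in> P then 0 else 1)" for a
  have mult: "f (a \<otimes> b) = f a + f b" if ab: "a \<in> carrier G" "b \<in> carrier G" for a b
  proof -
    have "b \<otimes> a = a \<otimes> b" using ab by (rule m_comm[symmetric])
    then have "a \<otimes> b \<in> P \<longleftrightarrow> (a \<in> P \<longleftrightarrow> b \<in> P)"
      using both[OF ab] cancel[of a b] cancel[of b a] ab P.m_closed[of a b] by metis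
    then show ?thesis by (simp add: f_def)
  qed
  have "f a * f (a \<otimes> b) = 0" if b: "b \<in> carrier G" and ab: "a \<in> repr G b" for a b
  proof (cases "b \<in> P")
    case True
    then have "a \<in> P" using sat ab by (auto simp: saturated_def)
    then show ?thesis by (simp add: f_def)
  next
    case False
    then show ?thesis
      using mult[OF repr_closed[OF ab] b] by (cases "f a") (simp_all add: f_def)
  qed
  moreover have "\<exists>a \<in> carrier G. f a \<noteq> 0"
    using proper P.subset by (auto simp: f_def)
  ultimately have "sign_character f"
    using mult unfolding sign_character_def by simp
  then show thesis by (rule that)
qed

end

section \<open>The group of triples over a well-ordered index set\<close>

locale well_ordered_index =
  fixes I :: "'i set" and r :: "'i rel"
  assumes well_order: "well_order_on I r"
begin

abbreviation "W \<equiv> W_group I r"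

lemma order_field: "(i, j) \<in> r \<Longrightarrow> i \<in> I \<and> j \<in> I"
  using well_order by (auto simp: order_on_defs)

lemma order_refl: "i \<in> I \<Longrightarrow> (i, i) \<in> r"
  using well_order by (auto simp: order_on_defs refl_on_def)

lemma order_antisym: "(i, j) \<in> r \<Longrightarrow> (j, i) \<in> r \<Longrightarrow> i = j"
  using well_order by (auto simp: order_on_defs antisym_def)

lemma order_total: "i \<in> I \<Longrightarrow> j \<in> I \<Longrightarrow> i = j \<or> (i, j) \<in> r - Id \<or> (j, i) \<in> r - Id"
  using well_order by (auto simp: order_on_defs total_on_def)

lemma W_carrier:
  "(\<alpha>, \<beta>, \<gamma>) \<in> carrier W \<longleftrightarrow> \<alpha> \<in> extensional I \<and> \<beta> \<in> extensional (r - Id) \<and> \<gamma> \<in> extensional I"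
  by (auto simp: W_group_def PiE_def)

lemma W_mult:
  "(\<alpha>, \<beta>, \<gamma>) \<otimes>\<^bsub>W\<^esub> (\<alpha>', \<beta>', \<gamma>') =
    (restrict (\<lambda>i. \<alpha> i + \<alpha>' i + \<gamma> i * \<gamma>' i) I,
     restrict (\<lambda>(i, j). \<beta> (i, j) + \<beta>' (i, j) + \<gamma>' i * \<gamma> j) (r - Id),
     restrict (\<lambda>i. \<gamma> i + \<gamma>' i) I)"
  by (simp add: W_group_def)

lemma W_one: "\<one>\<^bsub>W\<^esub> = (restrict (\<lambda>_. 0) I, restrict (\<lambda>_. 0) (r - Id), restrict (\<lambda>_. 0) I)"
  by (simp add: W_group_def)

lemma W_eqI:
  assumes "(\<alpha>, \<beta>, \<gamma>) \<in> carrier W" "(\<alpha>', \<beta>', \<gamma>') \<in> carrier W"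
    and "\<And>i. i \<in> I \<Longrightarrow> \<alpha> i = \<alpha>' i"
    and "\<And>i j. (i, j) \<in> r - Id \<Longrightarrow> \<beta> (i, j) = \<beta>' (i, j)"
    and "\<And>i. i \<in> I \<Longrightarrow> \<gamma> i = \<gamma>' i"
  shows "(\<alpha>, \<beta>, \<gamma>) = (\<alpha>', \<beta>', \<gamma>')"
proof -
  have "\<alpha> = \<alpha>'" "\<gamma> = \<gamma>'"
    using assms by (auto simp: W_carrier intro: extensionalityI)
  moreover have "\<beta> = \<beta>'"
    using assms by (intro extensionalityI[of _ "r - Id"]) (auto simp: W_carrier)
  ultimately show ?thesis by simp
qed

lemma W_mult_closed:
  "x \<in> carrier W \<Longrightarrow> y \<in> carrier W \<Longrightarrow> x \<otimes>\<^bsub>W\<^esub> y \<in> carrier W"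
  by (cases x; cases y) (simp add: W_mult W_carrier)

lemma W_group: "group W"
proof (rule groupI)
  show "\<one>\<^bsub>W\<^esub> \<in> carrier W" by (simp add: W_one W_carrier)
next
  fix x y z assume "x \<in> carrier W" "y \<in> carrier W" "z \<in> carrier W"
  then show "x \<otimes>\<^bsub>W\<^esub> y \<otimes>\<^bsub>W\<^esub> z = x \<otimes>\<^bsub>W\<^esub> (y \<otimes>\<^bsub>W\<^esub> z)"
    by (cases x; cases y; cases z; simp only: W_mult)
       (rule W_eqI; auto simp: W_carrier order_field algebra_simps)
next
  fix x assume "x \<in> carrier W"
  then show "\<one>\<^bsub>W\<^esub> \<otimes>\<^bsub>W\<^esub> x = x"
    by (cases x; simp only: W_mult W_one)
       (rule W_eqI; auto simp: W_carrier order_field)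
next
  fix x assume x: "x \<in> carrier W"
  obtain \<alpha> \<beta> \<gamma> where x_eq: "x = (\<alpha>, \<beta>, \<gamma>)" by (cases x)
  let ?y = "(restrict (\<lambda>i. \<alpha> i + \<gamma> i) I, restrict (\<lambda>(i, j). \<beta> (i, j) + \<gamma> i * \<gamma> j) (r - Id), \<gamma>)"
  have "?y \<otimes>\<^bsub>W\<^esub> x = \<one>\<^bsub>W\<^esub>"
    using x unfolding x_eq W_mult W_one
    by (intro W_eqI) (auto simp: W_carrier order_field algebra_simps)
  moreover have "?y \<in> carrier W" using x by (simp add: x_eq W_carrier)
  ultimately show "\<exists>y\<in>carrier W. y \<otimes>\<^bsub>W\<^esub> x = \<one>\<^bsub>W\<^esub>" by blast
qed (rule W_mult_closed)

sublocale W: group W by (rule W_group)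

lemma W_Frattini_iff:
  "(\<alpha>, \<beta>, \<gamma>) \<in> W_Frattini I r \<longleftrightarrow> (\<alpha>, \<beta>, \<gamma>) \<in> carrier W \<and> (\<forall>i \<in> I. \<gamma> i = 0)"
  by (simp add: W_Frattini_def)

lemma W_Frattini_carrier: "x \<in> W_Frattini I r \<Longrightarrow> x \<in> carrier W"
  by (cases x) (simp add: W_Frattini_iff)

lemma W_Frattini_mult_closed:
  "x \<in> W_Frattini I r \<Longrightarrow> y \<in> W_Frattini I r \<Longrightarrow> x \<otimes>\<^bsub>W\<^esub> y \<in> W_Frattini I r"
  by (cases x; cases y) (simp add: W_Frattini_iff W_mult W_carrier)

lemma W_Frattini_central:
  assumes "x \<in> W_Frattini I r" "y \<in> carrier W"
  shows "x \<otimes>\<^bsub>W\<^esub> y = y \<otimes>\<^bsub>W\<^esub> x"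
proof -
  obtain \<alpha> \<beta> \<gamma> \<alpha>' \<beta>' \<gamma>' where xy: "x = (\<alpha>, \<beta>, \<gamma>)" "y = (\<alpha>', \<beta>', \<gamma>')"
    by (cases x; cases y)
  show ?thesis
    using assms unfolding xy W_mult
    by (intro W_eqI) (auto simp: W_Frattini_iff W_carrier order_field add_ac)
qed

lemma W_Frattini_square:
  assumes "x \<in> W_Frattini I r"
  shows "x \<otimes>\<^bsub>W\<^esub> x = \<one>\<^bsub>W\<^esub>"
proof -
  obtain \<alpha> \<beta> \<gamma> where x: "x = (\<alpha>, \<beta>, \<gamma>)" by (cases x)
  show ?thesis
    using assms unfolding x W_mult W_one
    by (intro W_eqI) (auto simp: W_Frattini_iff W_carrier order_field)
qed

lemma W_Frattini_inv: "x \<in> W_Frattini I r \<Longrightarrow> inv\<^bsub>W\<^esub> x = x"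
  using W_Frattini_square W_Frattini_carrier W.inv_equality by blast

text \<open>
  The squares and the commutators in \<open>W\<close> depend only on the last components of the factors.
\<close>

definition square_elt :: "('i \<Rightarrow> bit) \<Rightarrow> 'i gal_elt"
  where "square_elt \<gamma> =
    (restrict \<gamma> I, restrict (\<lambda>(i, j). \<gamma> i * \<gamma> j) (r - Id), restrict (\<lambda>_. 0) I)"

definition commutator_elt :: "('i \<Rightarrow> bit) \<Rightarrow> ('i \<Rightarrow> bit) \<Rightarrow> 'i gal_elt"
  where "commutator_elt \<gamma> \<gamma>' =
    (restrict (\<lambda>_. 0) I, restrict (\<lambda>(i, j). \<gamma> i * \<gamma>' j + \<gamma>' i * \<gamma> j) (r - Id), restrict (\<lambda>_. 0) I)"

lemma square_elt_Frattini: "square_elt \<gamma> \<in> W_Frattini I r"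
  by (simp add: square_elt_def W_Frattini_iff W_carrier)

lemma commutator_elt_Frattini: "commutator_elt \<gamma> \<gamma>' \<in> W_Frattini I r"
  by (simp add: commutator_elt_def W_Frattini_iff W_carrier)

lemma W_square:
  assumes "(\<alpha>, \<beta>, \<gamma>) \<in> carrier W"
  shows "(\<alpha>, \<beta>, \<gamma>) \<otimes>\<^bsub>W\<^esub> (\<alpha>, \<beta>, \<gamma>) = square_elt \<gamma>"
  unfolding W_mult square_elt_def
  by (intro W_eqI) (auto simp: W_carrier order_field)

lemma W_commutator:
  assumes "(\<alpha>, \<beta>, \<gamma>) \<in> carrier W" "(\<alpha>', \<beta>', \<gamma>') \<in> carrier W"
  shows "(\<alpha>, \<beta>, \<gamma>) \<otimes>\<^bsub>W\<^esub> (\<alpha>', \<beta>', \<gamma>') =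
    commutator_elt \<gamma> \<gamma>' \<otimes>\<^bsub>W\<^esub> ((\<alpha>', \<beta>', \<gamma>') \<otimes>\<^bsub>W\<^esub> (\<alpha>, \<beta>, \<gamma>))"
  unfolding W_mult commutator_elt_def
  by (intro W_eqI) (auto simp: W_carrier order_field algebra_simps)

lemma P2_order: "q \<in> P2 r \<Longrightarrow> q (i, j) \<noteq> 0 \<Longrightarrow> i \<in> I \<and> j \<in> I \<and> (i = j \<or> (i, j) \<in> r - Id)"
  using order_field by (auto simp: P2_def)

lemma W_pairing_mult:
  assumes "x \<in> W_Frattini I r" "y \<in> W_Frattini I r" "q \<in> P2 r"
  shows "W_pairing (x \<otimes>\<^bsub>W\<^esub> y) q = W_pairing x q + W_pairing y q"
proof -
  obtain \<alpha> \<beta> \<gamma> \<alpha>' \<beta>' \<gamma>' where xy: "x = (\<alpha>, \<beta>, \<gamma>)" "y = (\<alpha>', \<beta>', \<gamma>')"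
    by (cases x; cases y)
  have "(case p of (i, j) \<Rightarrow> q (i, j) * (if i = j
            then restrict (\<lambda>i. \<alpha> i + \<alpha>' i + \<gamma> i * \<gamma>' i) I i
            else restrict (\<lambda>(i, j). \<beta> (i, j) + \<beta>' (i, j) + \<gamma>' i * \<gamma> j) (r - Id) (i, j)))
        = (case p of (i, j) \<Rightarrow> q (i, j) * (if i = j then \<alpha> i else \<beta> (i, j)))
        + (case p of (i, j) \<Rightarrow> q (i, j) * (if i = j then \<alpha>' i else \<beta>' (i, j)))"
    if p: "p \<in> {p. q p \<noteq> 0}" for p
  proof -
    obtain i j where ij: "p = (i, j)" by (cases p)
    show ?thesis
      using P2_order[OF assms(3), of i j] p assms(1,2) unfolding ij xy
      by (auto simp: W_Frattini_iff distrib_left)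
  qed
  then show ?thesis
    unfolding xy W_mult W_pairing_def prod.case sum.distrib[symmetric]
    by (rule sum.cong[OF refl])
qed

lemma W_pairing_one: "q \<in> P2 r \<Longrightarrow> W_pairing \<one>\<^bsub>W\<^esub> q = 0"
  unfolding W_one W_pairing_def prod.case using P2_order by (intro sum.neutral) auto

text \<open>
  On \<open>{\<gamma> = 0}\<close> the group law is addition of coordinates, so that the pairing is bilinear.
\<close>

lemma annihilator_subgroup:
  assumes "Q \<subseteq> P2 r"
  shows "subgroup {w \<in> W_Frattini I r. \<forall>q \<in> Q. W_pairing w q = 0} W"
proof (rule W.subgroupI)
  have "\<one>\<^bsub>W\<^esub> \<in> W_Frattini I r" by (simp add: W_one W_Frattini_iff W_carrier)
  then show "{w \<in> W_Frattini I r. \<forall>q \<in> Q. W_pairing w q = 0} \<noteq> {}"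
    using assms W_pairing_one by blast
qed (use assms in \<open>auto simp: W_Frattini_carrier W_Frattini_inv W_Frattini_mult_closed
    W_pairing_mult subset_iff\<close>)

lemma central_subgroup_normal:
  assumes "subgroup H W" "H \<subseteq> W_Frattini I r"
  shows "H \<lhd> W"
proof (rule W.normalI[OF assms(1)])
  have "h \<otimes>\<^bsub>W\<^esub> x = x \<otimes>\<^bsub>W\<^esub> h" if "h \<in> H" "x \<in> carrier W" for h x
    using W_Frattini_central[OF subsetD[OF assms(2) that(1)] that(2)] .
  then show "\<forall>x\<in>carrier W. H #>\<^bsub>W\<^esub> x = x <#\<^bsub>W\<^esub> H"
    by (simp add: r_coset_def l_coset_def)
qed

end

section \<open>The Frattini subgroup of a central quotient\<close>

declare mult_FactGroup [simp del] one_FactGroup [simp del]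

locale central_quotient = well_ordered_index I r for I :: "'i set" and r :: "'i rel" +
  fixes V :: "'i gal_elt set"
  assumes V_subgroup: "subgroup V (W_group I r)"
    and V_Frattini: "V \<subseteq> W_Frattini I r"
begin

abbreviation "pr w \<equiv> V #>\<^bsub>W\<^esub> w"
abbreviation "T \<equiv> quotient_topology (W_topology I r) (\<lambda>w. V #>\<^bsub>W\<^esub> w)"

sublocale V: normal V W
  by (rule central_subgroup_normal[OF V_subgroup V_Frattini])

sublocale Q: group "W Mod V"
  by (rule V.factorgroup_is_group)

sublocale pr: group_hom W "W Mod V" "\<lambda>w. V #>\<^bsub>W\<^esub> w"
  by unfold_locales (rule V.r_coset_hom_Mod)

lemma Mod_carrier: "carrier (W Mod V) = pr ` carrier W"
  by (auto simp: FactGroup_def RCOSETS_def)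

lemma pr_eq_one: "x \<in> carrier W \<Longrightarrow> pr x = \<one>\<^bsub>W Mod V\<^esub> \<longleftrightarrow> x \<in> V"
  using W.coset_join1[of V x] W.coset_join2[of x V] V_subgroup V.subset
  by (auto simp: FactGroup_def)

lemma involution_pr:
  assumes "w \<in> carrier W"
  shows "involution (W Mod V) (pr w) \<longleftrightarrow> w \<notin> V \<and> w \<otimes>\<^bsub>W\<^esub> w \<in> V"
  using assms pr_eq_one[of w] pr_eq_one[of "w \<otimes>\<^bsub>W\<^esub> w"] pr.hom_mult[of w w]
  by (auto simp: involution_def)

lemma topspace_W: "topspace (W_topology I r) = carrier W"
  by (simp add: W_topology_def W_group_def)

lemma openin_Mod:
  "openin T U \<longleftrightarrow> U \<subseteq> carrier (W Mod V) \<and> openin (W_topology I r) {x \<in> carrier W. pr x \<in> U}"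
  by (simp add: openin_quotient_topology topspace_W Mod_carrier)

lemma continuous_map_alpha:
  "i \<in> I \<Longrightarrow> continuous_map (W_topology I r) (discrete_topology UNIV) (\<lambda>w. fst w i)"
  unfolding W_topology_def
  using continuous_map_compose[OF continuous_map_fst continuous_map_product_projection]
  by (auto simp: o_def)

lemma continuous_map_beta:
  "p \<in> r - Id \<Longrightarrow> continuous_map (W_topology I r) (discrete_topology UNIV) (\<lambda>w. fst (snd w) p)"
  unfolding W_topology_def
  using continuous_map_compose[OF continuous_map_compose[OF continuous_map_snd continuous_map_fst]
      continuous_map_product_projection[of p "r - Id"]]
  by (simp add: o_def del: Diff_iff)

lemma continuous_map_gamma:
  "i \<in> I \<Longrightarrow> continuous_map (W_topology I r) (discrete_topology UNIV) (\<lambda>w. snd (snd w) i)"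
  unfolding W_topology_def
  using continuous_map_compose[OF continuous_map_compose[OF continuous_map_snd continuous_map_snd]
      continuous_map_product_projection]
  by (auto simp: o_def)

text \<open>
  Multiplication by an element with \<open>\<gamma> = 0\<close> only shifts the coordinates.
\<close>

lemma continuous_map_translation:
  assumes x: "x \<in> W_Frattini I r"
  shows "continuous_map (W_topology I r) (W_topology I r) (\<lambda>w. x \<otimes>\<^bsub>W\<^esub> w)"
proof -
  obtain \<alpha> \<beta> \<gamma> where x_eq: "x = (\<alpha>, \<beta>, \<gamma>)" by (cases x)
  have mult: "x \<otimes>\<^bsub>W\<^esub> w = (restrict (\<lambda>i. \<alpha> i + fst w i) I,
      restrict (\<lambda>p. \<beta> p + fst (snd w) p) (r - Id), restrict (\<lambda>i. snd (snd w) i) I)" for w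
    using x unfolding x_eq by (cases w) (auto simp: W_mult W_Frattini_iff fun_eq_iff order_field)
  have shift: "continuous_map (W_topology I r) (discrete_topology UNIV) (\<lambda>w. c + g w)"
    if "continuous_map (W_topology I r) (discrete_topology UNIV) g" for g and c :: bit
    using continuous_map_compose[OF that, of "discrete_topology UNIV" "\<lambda>t. c + t"]
    by (simp add: o_def)
  show ?thesis
    unfolding mult
    apply (subst (2) W_topology_def)
    apply (intro continuous_map_pairedI)
      apply (auto simp: continuous_map_componentwise intro!: shift
        continuous_map_alpha continuous_map_beta continuous_map_gamma)
    done
qed

lemma gamma_mult:
  assumes "i \<in> I"
  shows "snd (snd (x \<otimes>\<^bsub>W\<^esub> y)) i = snd (snd x) i + snd (snd y) i"
  using assms by (cases x; cases y) (simp add: W_mult)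

text \<open>
  For each index \<open>i\<close> the image of \<open>{\<gamma>\<^sub>i = 0}\<close> is open and, if it is proper, of index 2 and
  therefore maximal.
\<close>

lemma Frattini_subset: "Frattini (W Mod V) T \<subseteq> pr ` W_Frattini I r"
proof
  fix C assume C: "C \<in> Frattini (W Mod V) T"
  then obtain w where w: "w \<in> carrier W" "C = pr w"
    by (auto simp: Frattini_def Mod_carrier)
  have "snd (snd w) i = 0" if i: "i \<in> I" for i
  proof -
    define K where "K = {x \<in> carrier W. snd (snd x) i = 0}"
    have K: "subgroup K W"
    proof (rule W.subgroupI)
      have "\<one>\<^bsub>W\<^esub> \<in> K"
        using i by (simp add: K_def W_one W_carrier)
      then show "K \<noteq> {}" by blast
    next
      fix x assume "x \<in> K"
      then have "x \<in> carrier W" "snd (snd x) i = 0" by (auto simp: K_def)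
      moreover have "snd (snd (inv\<^bsub>W\<^esub> x \<otimes>\<^bsub>W\<^esub> x)) i = 0"
        using calculation i by (simp add: W_one)
      ultimately show "inv\<^bsub>W\<^esub> x \<in> K"
        using gamma_mult[OF i, of "inv\<^bsub>W\<^esub> x" x] by (simp add: K_def)
    qed (auto simp: K_def gamma_mult[OF i])
    have V_K: "V \<subseteq> K"
      using V_Frattini i by (auto simp: K_def W_Frattini_def)
    have pr_K: "pr x \<in> pr ` K \<longleftrightarrow> x \<in> K" if x: "x \<in> carrier W" for x
    proof
      assume "pr x \<in> pr ` K"
      then obtain k where k: "k \<in> K" "pr x = pr k" by blast
      have kW: "k \<in> carrier W" using k by (simp add: K_def)
      have "pr (x \<otimes>\<^bsub>W\<^esub> inv\<^bsub>W\<^esub> k) = pr (k \<otimes>\<^bsub>W\<^esub> inv\<^bsub>W\<^esub> k)"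
        using x kW k(2) by (simp only: pr.hom_mult W.inv_closed)
      then have "x \<otimes>\<^bsub>W\<^esub> inv\<^bsub>W\<^esub> k \<in> K"
        using V_K x kW pr_eq_one[of "x \<otimes>\<^bsub>W\<^esub> inv\<^bsub>W\<^esub> k"] by auto
      then have "(x \<otimes>\<^bsub>W\<^esub> inv\<^bsub>W\<^esub> k) \<otimes>\<^bsub>W\<^esub> k \<in> K"
        using k(1) subgroup.m_closed[OF K] by blast
      then show "x \<in> K" using x kW by (simp add: W.m_assoc)
    qed blast
    have sub: "subgroup (pr ` K) (W Mod V)"
      by (rule pr.subgroup_img_is_subgroup[OF K])
    have "maximal_open_subgroup (W Mod V) T (pr ` K)" if x: "x \<in> carrier W" "x \<notin> K" for x
      unfolding maximal_open_subgroup_def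
    proof (intro conjI allI impI sub)
      have "{x \<in> carrier W. pr x \<in> pr ` K} = {x \<in> topspace (W_topology I r). snd (snd x) i \<in> {0}}"
        using pr_K by (auto simp: topspace_W K_def)
      moreover have "openin (W_topology I r) {x \<in> topspace (W_topology I r). snd (snd x) i \<in> {0}}"
        by (rule openin_continuous_map_preimage[OF continuous_map_gamma[OF i]]) simp
      ultimately show "openin T (pr ` K)"
        using subgroup.subset[OF sub] by (simp add: openin_Mod)
      show "pr ` K \<noteq> carrier (W Mod V)"
        using x(2) pr_K[OF x(1)] pr.hom_closed[OF x(1)] by metis
    next
      fix N assume N: "subgroup N (W Mod V) \<and> openin T N \<and> N \<noteq> carrier (W Mod V) \<and> pr ` K \<subseteq> N"
      then interpret N: subgroup N "W Mod V" by simp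
      show "N = pr ` K"
      proof (rule ccontr)
        assume "N \<noteq> pr ` K"
        then obtain Z where Z: "Z \<in> N" "Z \<notin> pr ` K"
          using N by blast
        obtain x where "x \<in> carrier W" "Z = pr x"
          using subsetD[OF N.subset Z(1)] unfolding Mod_carrier by (rule imageE)
        with Z have x: "x \<in> carrier W" "pr x \<in> N" "x \<notin> K"
          by auto
        have "pr y \<in> N" if y: "y \<in> carrier W" for y
        proof (cases "y \<in> K")
          case False
          then have "y \<otimes>\<^bsub>W\<^esub> x \<in> K"
            using x y gamma_mult[OF i] by (auto simp: K_def bit_not_zero_iff)
          then have "pr (y \<otimes>\<^bsub>W\<^esub> x) \<in> N" using N by blast
          then have "pr (y \<otimes>\<^bsub>W\<^esub> x) \<otimes>\<^bsub>W Mod V\<^esub> inv\<^bsub>W Mod V\<^esub> (pr x) \<in> N"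
            using x(2) by blast
          moreover have "pr (y \<otimes>\<^bsub>W\<^esub> x) \<otimes>\<^bsub>W Mod V\<^esub> inv\<^bsub>W Mod V\<^esub> (pr x) = pr y"
            unfolding pr.hom_mult[OF y x(1)] using pr.hom_closed[OF y] pr.hom_closed[OF x(1)]
            by (simp only: Q.m_assoc Q.r_inv Q.r_one Q.inv_closed)
          ultimately show ?thesis by simp
        qed (use N in blast)
        then have "carrier (W Mod V) \<subseteq> N"
          by (auto simp: Mod_carrier)
        then show False
          using N N.subset by blast
      qed
    qed
    moreover have "w \<in> K" if "maximal_open_subgroup (W Mod V) T (pr ` K)"
      using that C w(2) pr_K[OF w(1)] by (simp add: Frattini_def)
    ultimately have "w \<in> K"
      using w(1) by metis
    then show "snd (snd w) i = 0"
      by (simp add: K_def)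
  qed
  then have "w \<in> W_Frattini I r"
    using w(1) by (cases w) (simp add: W_Frattini_iff)
  then show "C \<in> pr ` W_Frattini I r"
    using w(2) by blast
qed

text \<open>
  For finite \<open>A\<close> and \<open>C\<close> these elements are generated by squares and commutators, and they
  are dense in \<open>{\<gamma> = 0}\<close>.
\<close>

definition finite_elt :: "'i set \<Rightarrow> ('i \<times> 'i) set \<Rightarrow> 'i gal_elt"
  where "finite_elt A C =
    (restrict (\<lambda>i. if i \<in> A then 1 else 0) I, restrict (\<lambda>p. if p \<in> C then 1 else 0) (r - Id),
     restrict (\<lambda>_. 0) I)"

lemma finite_elt_Frattini: "finite_elt A C \<in> W_Frattini I r"
  by (simp add: finite_elt_def W_Frattini_iff W_carrier)

lemma finite_elt_insert1:
  assumes "i \<in> I" "i \<notin> A"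
  shows "finite_elt (insert i A) C = square_elt (\<lambda>k. if k = i then 1 else 0) \<otimes>\<^bsub>W\<^esub> finite_elt A C"
  using assms unfolding square_elt_def finite_elt_def W_mult
  by (intro W_eqI) (auto simp: W_carrier order_field)

text \<open>
  The commutator of the unit vectors for \<open>i < j\<close> has the single entry \<open>\<beta>\<^sub>i\<^sub>j = 1\<close>: the other
  summand would contribute to the pair \<open>(j, i)\<close>, which is not in the order.
\<close>

lemma finite_elt_insert2:
  assumes ij: "(i, j) \<in> r - Id" "(i, j) \<notin> C"
  shows "finite_elt {} (insert (i, j) C) =
    commutator_elt (\<lambda>k. if k = i then 1 else 0) (\<lambda>k. if k = j then 1 else 0) \<otimes>\<^bsub>W\<^esub> finite_elt {} C"
proof -
  have "k = i \<and> l = j" if "(k, l) \<in> r - Id" "k = j" "l = i" for k l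
    using that ij(1) order_antisym by blast
  then show ?thesis
    using assms unfolding commutator_elt_def finite_elt_def W_mult
    by (intro W_eqI) (auto simp: W_carrier order_field)
qed

lemma finite_elt_mem:
  assumes H: "subgroup H W"
    and squares: "\<And>\<gamma>. square_elt \<gamma> \<in> H"
    and commutators: "\<And>\<gamma> \<gamma>'. commutator_elt \<gamma> \<gamma>' \<in> H"
    and A: "finite A" "A \<subseteq> I" and C: "finite C" "C \<subseteq> r - Id"
  shows "finite_elt A C \<in> H"
  using A
proof (induction A rule: finite_induct)
  case empty
  show ?case
    using C
  proof (induction C rule: finite_induct)
    case empty
    have "finite_elt {} {} = \<one>\<^bsub>W\<^esub>"
      by (simp add: finite_elt_def W_one)
    then show ?case using subgroup.one_closed[OF H] by simp
  next
    case (insert p C)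
    then show ?case
      using subgroup.m_closed[OF H commutators] finite_elt_insert2 by (cases p) auto
  qed
next
  case (insert i A)
  then show ?case
    using subgroup.m_closed[OF H squares] finite_elt_insert1 by auto
qed

text \<open>
  An open set around the identity contains a basic one, which restricts finitely many
  coordinates only.
\<close>

lemma open_contains_tail:
  assumes "openin (W_topology I r) H" "\<one>\<^bsub>W\<^esub> \<in> H"
  obtains A C where "finite A" "A \<subseteq> I" "finite C" "C \<subseteq> r - Id"
    "\<And>\<alpha> \<beta> \<gamma>. (\<alpha>, \<beta>, \<gamma>) \<in> W_Frattini I r \<Longrightarrow> \<forall>i \<in> A. \<alpha> i = 0 \<Longrightarrow> \<forall>p \<in> C. \<beta> p = 0 \<Longrightarrow> (\<alpha>, \<beta>, \<gamma>) \<in> H"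
proof -
  let ?z = "\<lambda>J. restrict (\<lambda>_. 0 :: bit) J"
  let ?pt = "\<lambda>J. product_topology (\<lambda>_. discrete_topology (UNIV :: bit set)) J"
  obtain U1 U where U1: "openin (?pt I) U1" "?z I \<in> U1"
    and U: "openin (prod_topology (?pt (r - Id)) (?pt I)) U" "(?z (r - Id), ?z I) \<in> U"
    and U1_U: "U1 \<times> U \<subseteq> H"
    using assms unfolding W_topology_def openin_prod_topology_alt W_one by metis
  obtain U2 U3 where U2: "openin (?pt (r - Id)) U2" "?z (r - Id) \<in> U2"
    and U3: "openin (?pt I) U3" "?z I \<in> U3" and U2_U3: "U2 \<times> U3 \<subseteq> U"
    using U unfolding openin_prod_topology_alt by metis
  have basic: "\<exists>A. finite A \<and> A \<subseteq> J \<and> (\<forall>f \<in> extensional J. (\<forall>p \<in> A. f p = 0) \<longrightarrow> f \<in> Y)"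
    if Y: "openin (?pt J) Y" "?z J \<in> Y" for J :: "'k set" and Y
  proof -
    obtain N where N: "finite {i \<in> J. N i \<noteq> UNIV}" "?z J \<in> Pi\<^sub>E J N" "Pi\<^sub>E J N \<subseteq> Y"
      using Y unfolding openin_product_topology_alt by auto
    have "f \<in> Pi\<^sub>E J N" if f: "f \<in> extensional J" "\<forall>p \<in> {i \<in> J. N i \<noteq> UNIV}. f p = 0" for f
    proof (rule PiE_I)
      fix p assume p: "p \<in> J"
      have "0 \<in> N p" using PiE_mem[OF N(2) p] p by simp
      then show "f p \<in> N p" using f p by (cases "N p = UNIV") auto
    qed (use f in \<open>auto simp: extensional_def\<close>)
    then show ?thesis
      using N by (intro exI[of _ "{i \<in> J. N i \<noteq> UNIV}"]) blast
  qed
  from basic[OF U1] obtain A where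
    A: "finite A \<and> A \<subseteq> I \<and> (\<forall>f \<in> extensional I. (\<forall>p \<in> A. f p = 0) \<longrightarrow> f \<in> U1)" ..
  from basic[OF U2] obtain C where
    C: "finite C \<and> C \<subseteq> r - Id \<and> (\<forall>f \<in> extensional (r - Id). (\<forall>p \<in> C. f p = 0) \<longrightarrow> f \<in> U2)" ..
  have "(\<alpha>, \<beta>, \<gamma>) \<in> H"
    if w: "(\<alpha>, \<beta>, \<gamma>) \<in> W_Frattini I r" "\<forall>i \<in> A. \<alpha> i = 0" "\<forall>p \<in> C. \<beta> p = 0" for \<alpha> \<beta> \<gamma>
  proof -
    have "\<gamma> = ?z I"
      using w(1) by (auto simp: W_Frattini_iff W_carrier intro: extensionalityI)
    moreover have "\<alpha> \<in> U1" "\<beta> \<in> U2"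
      using w A C by (simp_all add: W_Frattini_iff W_carrier)
    ultimately have "(\<beta>, \<gamma>) \<in> U" "\<alpha> \<in> U1"
      using subsetD[OF U2_U3] U3(2) by auto
    then show ?thesis
      using subsetD[OF U1_U] by auto
  qed
  with A C show thesis by (intro that[of A C]) simp_all
qed

text \<open>
  An element of \<open>{\<gamma> = 0}\<close> is the product of a finite one, which agrees with it on the finitely
  many coordinates that matter for \<open>H\<close>, and of one which vanishes there.
\<close>

lemma Frattini_mem_if_squares_commutators:
  assumes H: "subgroup H W" and op: "openin (W_topology I r) H"
    and squares: "\<And>\<gamma>. square_elt \<gamma> \<in> H"
    and commutators: "\<And>\<gamma> \<gamma>'. commutator_elt \<gamma> \<gamma>' \<in> H"
  shows "W_Frattini I r \<subseteq> H"
proof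
  fix w assume w: "w \<in> W_Frattini I r"
  obtain \<alpha> \<beta> \<gamma> where w_eq: "w = (\<alpha>, \<beta>, \<gamma>)" by (cases w)
  obtain A C where AC: "finite A" "A \<subseteq> I" "finite C" "C \<subseteq> r - Id"
    and tail: "\<And>\<alpha> \<beta> \<gamma>. (\<alpha>, \<beta>, \<gamma>) \<in> W_Frattini I r \<Longrightarrow> \<forall>i \<in> A. \<alpha> i = 0 \<Longrightarrow> \<forall>p \<in> C. \<beta> p = 0 \<Longrightarrow> (\<alpha>, \<beta>, \<gamma>) \<in> H"
    using open_contains_tail[OF op subgroup.one_closed[OF H]] by blast
  define e where "e = finite_elt {i \<in> A. \<alpha> i = 1} {p \<in> C. \<beta> p = 1}"
  have "e \<in> H"
    unfolding e_def using AC by (intro finite_elt_mem[OF H squares commutators]) auto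
  moreover have "e \<in> W_Frattini I r"
    unfolding e_def by (rule finite_elt_Frattini)
  ultimately have e: "e \<in> H" "e \<in> W_Frattini I r" .
  have eq: "e \<otimes>\<^bsub>W\<^esub> w =
      (restrict (\<lambda>i. (if i \<in> A \<and> \<alpha> i = 1 then 1 else 0) + \<alpha> i) I,
       restrict (\<lambda>p. (if p \<in> C \<and> \<beta> p = 1 then 1 else 0) + \<beta> p) (r - Id),
       restrict (\<lambda>i. \<gamma> i) I)"
    unfolding e_def finite_elt_def w_eq W_mult by (auto simp: fun_eq_iff order_field)
  have "e \<otimes>\<^bsub>W\<^esub> w \<in> H"
    unfolding eq
  proof (rule tail)
    show "(restrict (\<lambda>i. (if i \<in> A \<and> \<alpha> i = 1 then 1 else 0) + \<alpha> i) I,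
       restrict (\<lambda>p. (if p \<in> C \<and> \<beta> p = 1 then 1 else 0) + \<beta> p) (r - Id),
       restrict (\<lambda>i. \<gamma> i) I) \<in> W_Frattini I r"
      using w unfolding w_eq by (simp add: W_Frattini_iff W_carrier)
    show "\<forall>i\<in>A. restrict (\<lambda>i. (if i \<in> A \<and> \<alpha> i = 1 then 1 else 0) + \<alpha> i) I i = 0"
      using AC by (auto simp: bit_not_one_iff)
    show "\<forall>p\<in>C. restrict (\<lambda>p. (if p \<in> C \<and> \<beta> p = 1 then 1 else 0) + \<beta> p) (r - Id) p = 0"
      using AC by (auto simp: bit_not_one_iff)
  qed
  then have "e \<otimes>\<^bsub>W\<^esub> (e \<otimes>\<^bsub>W\<^esub> w) \<in> H"
    using e subgroup.m_closed[OF H] by blast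
  moreover have "e \<otimes>\<^bsub>W\<^esub> (e \<otimes>\<^bsub>W\<^esub> w) = w"
    using e w W_Frattini_carrier W_Frattini_square
    by (simp add: W.m_assoc[symmetric])
  ultimately show "w \<in> H" by simp
qed

text \<open>
  Let \<open>M\<close> be a maximal open subgroup that misses the class of some \<open>w\<close> with \<open>\<gamma> = 0\<close>. As
  \<open>w\<close> is central of order at most 2, \<open>M\<close> and its translate by \<open>w\<close> form an open subgroup, so
  they cover the group. Up to a factor \<open>w\<close> every element therefore comes from \<open>M\<close>, and since
  squares and commutators do not see this factor, all of them come from \<open>M\<close>. But then so does
  \<open>w\<close>.
\<close>

lemma Frattini_superset: "pr ` W_Frattini I r \<subseteq> Frattini (W Mod V) T"
proof -
  have "pr w \<in> M" if w: "w \<in> W_Frattini I r" and M: "maximal_open_subgroup (W Mod V) T M" for w M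
  proof (rule ccontr)
    assume not_in: "pr w \<notin> M"
    interpret M: subgroup M "W Mod V"
      using M by (simp add: maximal_open_subgroup_def)
    have wc: "w \<in> carrier W" using w by (rule W_Frattini_carrier)
    have ww: "w \<otimes>\<^bsub>W\<^esub> (w \<otimes>\<^bsub>W\<^esub> x) = x" if "x \<in> carrier W" for x
      using that wc W_Frattini_square[OF w] by (simp add: W.m_assoc[symmetric])
    define H where "H = {x \<in> carrier W. pr x \<in> M}"
    \<comment> \<open>The preimage of the union of \<open>M\<close> with its translate; recall \<open>w = w\<^sup>-\<^sup>1\<close>.\<close>
    define N where "N = {x \<in> carrier W. x \<in> H \<or> w \<otimes>\<^bsub>W\<^esub> x \<in> H}"
    have H_open: "openin (W_topology I r) H"
      using M by (simp add: H_def maximal_open_subgroup_def openin_Mod)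
    have H: "subgroup H W"
    proof (rule W.subgroupI)
      have "\<one>\<^bsub>W\<^esub> \<in> H"
        unfolding H_def using pr.hom_one M.one_closed by simp
      then show "H \<noteq> {}" by blast
    qed (auto simp: H_def pr.hom_mult pr.hom_inv)
    have N: "subgroup N W"
    proof (rule W.subgroupI)
      have "\<one>\<^bsub>W\<^esub> \<in> N" using subgroup.one_closed[OF H] by (simp add: N_def)
      then show "N \<noteq> {}" by blast
    next
      fix x assume x: "x \<in> N"
      then have xc: "x \<in> carrier W" by (simp add: N_def)
      have "inv\<^bsub>W\<^esub> (w \<otimes>\<^bsub>W\<^esub> x) = w \<otimes>\<^bsub>W\<^esub> inv\<^bsub>W\<^esub> x"
        using xc wc W_Frattini_central[OF w, of "inv\<^bsub>W\<^esub> x"] W_Frattini_inv[OF w]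
        by (simp add: W.inv_mult_group)
      then show "inv\<^bsub>W\<^esub> x \<in> N"
        using x xc subgroup.m_inv_closed[OF H, of x] subgroup.m_inv_closed[OF H, of "w \<otimes>\<^bsub>W\<^esub> x"]
        by (auto simp: N_def)
    next
      fix x y assume x: "x \<in> N" and y: "y \<in> N"
      then have c: "x \<in> carrier W" "y \<in> carrier W" by (simp_all add: N_def)
      have 1: "(w \<otimes>\<^bsub>W\<^esub> x) \<otimes>\<^bsub>W\<^esub> y = w \<otimes>\<^bsub>W\<^esub> (x \<otimes>\<^bsub>W\<^esub> y)"
        using c wc by (simp add: W.m_assoc)
      have 2: "x \<otimes>\<^bsub>W\<^esub> (w \<otimes>\<^bsub>W\<^esub> y) = w \<otimes>\<^bsub>W\<^esub> (x \<otimes>\<^bsub>W\<^esub> y)"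
        using c wc W_Frattini_central[OF w c(1)] by (simp add: W.m_assoc[symmetric])
      have 3: "(w \<otimes>\<^bsub>W\<^esub> x) \<otimes>\<^bsub>W\<^esub> (w \<otimes>\<^bsub>W\<^esub> y) = x \<otimes>\<^bsub>W\<^esub> y"
        using c wc 2 ww[of "x \<otimes>\<^bsub>W\<^esub> y"] by (simp add: W.m_assoc)
      note closed = subgroup.m_closed[OF H]
      show "x \<otimes>\<^bsub>W\<^esub> y \<in> N"
        using x y c closed[of x y] closed[of "w \<otimes>\<^bsub>W\<^esub> x" y] closed[of x "w \<otimes>\<^bsub>W\<^esub> y"]
          closed[of "w \<otimes>\<^bsub>W\<^esub> x" "w \<otimes>\<^bsub>W\<^esub> y"]
        unfolding N_def 1 2 3 by auto
    qed (auto simp: N_def)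
    have N_open: "openin (W_topology I r) N"
    proof -
      have "N = H \<union> {x \<in> topspace (W_topology I r). w \<otimes>\<^bsub>W\<^esub> x \<in> H}"
        by (auto simp: N_def H_def topspace_W)
      then show ?thesis
        using H_open openin_continuous_map_preimage[OF continuous_map_translation[OF w] H_open]
        by (simp add: openin_Un)
    qed
    have pr_N: "{x \<in> carrier W. pr x \<in> pr ` N} = N"
    proof
      show "{x \<in> carrier W. pr x \<in> pr ` N} \<subseteq> N"
      proof clarify
        fix x y assume x: "x \<in> carrier W" and eq: "pr x = pr y" and y: "y \<in> N"
        have "pr (w \<otimes>\<^bsub>W\<^esub> x) = pr (w \<otimes>\<^bsub>W\<^esub> y)"
          using x y wc eq by (simp add: N_def pr.hom_mult)
        then show "x \<in> N"
          using x y eq wc by (auto simp: N_def H_def)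
      qed
      show "N \<subseteq> {x \<in> carrier W. pr x \<in> pr ` N}" by (auto simp: N_def)
    qed
    have "subgroup (pr ` N) (W Mod V)"
      by (rule pr.subgroup_img_is_subgroup[OF N])
    moreover have "openin T (pr ` N)"
      using N_open pr_N Mod_carrier by (auto simp: openin_Mod N_def)
    moreover have "M \<subseteq> pr ` N"
      using M.subset Mod_carrier by (auto simp: N_def H_def)
    moreover have "pr ` N \<noteq> M"
    proof -
      have "w \<in> N"
        using wc W_Frattini_square[OF w] M.one_closed pr.hom_one by (simp add: N_def H_def)
      then show ?thesis using not_in by blast
    qed
    ultimately have "pr ` N = carrier (W Mod V)"
      using M unfolding maximal_open_subgroup_def by blast
    then have cover: "x \<in> H \<or> w \<otimes>\<^bsub>W\<^esub> x \<in> H" if "x \<in> carrier W" for x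
      using that pr_N by (auto simp: Mod_carrier N_def)
    \<comment> \<open>Every last component occurs in \<open>H\<close>, because \<open>w\<close> does not change it.\<close>
    have lift: "\<exists>\<alpha> \<beta>. (\<alpha>, \<beta>, restrict \<gamma> I) \<in> H" for \<gamma>
    proof -
      obtain \<alpha>0 \<beta>0 \<gamma>0 where w_eq: "w = (\<alpha>0, \<beta>0, \<gamma>0)" by (cases w)
      let ?x = "(restrict (\<lambda>_. 0) I, restrict (\<lambda>_. 0) (r - Id), restrict \<gamma> I) :: 'i gal_elt"
      have "snd (snd (w \<otimes>\<^bsub>W\<^esub> ?x)) = restrict \<gamma> I"
        using w unfolding w_eq by (auto simp: W_mult W_Frattini_iff fun_eq_iff)
      moreover have "?x \<in> carrier W" by (simp add: W_carrier)
      ultimately show ?thesis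
        using cover[of ?x] by (metis prod.collapse)
    qed
    have squares: "square_elt \<gamma> \<in> H" for \<gamma>
    proof -
      obtain \<alpha> \<beta> where x: "(\<alpha>, \<beta>, restrict \<gamma> I) \<in> H" using lift by blast
      then have "square_elt (restrict \<gamma> I) \<in> H"
        using W_square[of \<alpha> \<beta> "restrict \<gamma> I"] subgroup.m_closed[OF H x x] by (auto simp: H_def)
      moreover have "square_elt (restrict \<gamma> I) = square_elt \<gamma>"
        by (auto simp: square_elt_def fun_eq_iff order_field)
      ultimately show ?thesis by simp
    qed
    have commutators: "commutator_elt \<gamma> \<gamma>' \<in> H" for \<gamma> \<gamma>'
    proof -
      obtain \<alpha> \<beta> \<alpha>' \<beta>' where x: "(\<alpha>, \<beta>, restrict \<gamma> I) \<in> H" and y: "(\<alpha>', \<beta>', restrict \<gamma>' I) \<in> H"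
        using lift by blast
      let ?x = "(\<alpha>, \<beta>, restrict \<gamma> I)" and ?y = "(\<alpha>', \<beta>', restrict \<gamma>' I)"
      let ?c = "commutator_elt (restrict \<gamma> I) (restrict \<gamma>' I)"
      have c: "?x \<in> carrier W" "?y \<in> carrier W" "?c \<in> carrier W"
        using x y W_Frattini_carrier commutator_elt_Frattini by (auto simp: H_def)
      have "(?x \<otimes>\<^bsub>W\<^esub> ?y) \<otimes>\<^bsub>W\<^esub> inv\<^bsub>W\<^esub> (?y \<otimes>\<^bsub>W\<^esub> ?x) \<in> H"
        using x y subgroup.m_closed[OF H] subgroup.m_inv_closed[OF H] by blast
      also have "(?x \<otimes>\<^bsub>W\<^esub> ?y) \<otimes>\<^bsub>W\<^esub> inv\<^bsub>W\<^esub> (?y \<otimes>\<^bsub>W\<^esub> ?x) = ?c"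
        unfolding W_commutator[OF c(1,2)] using c by (simp add: W.m_assoc del: W.inv_mult_group)
      also have "?c = commutator_elt \<gamma> \<gamma>'"
        by (auto simp: commutator_elt_def fun_eq_iff order_field)
      finally show ?thesis .
    qed
    have "w \<in> H"
      using Frattini_mem_if_squares_commutators[OF H H_open squares commutators] w by blast
    then show False using not_in by (simp add: H_def)
  qed
  moreover have "pr w \<in> carrier (W Mod V)" if "w \<in> W_Frattini I r" for w
    using that W_Frattini_carrier Mod_carrier by blast
  ultimately show ?thesis
    by (auto simp: Frattini_def)
qed

lemma Frattini_Mod: "Frattini (W Mod V) T = pr ` W_Frattini I r"
  using Frattini_subset Frattini_superset by blast

lemma pr_Frattini_iff:
  assumes "w \<in> carrier W"
  shows "pr w \<in> Frattini (W Mod V) T \<longleftrightarrow> w \<in> W_Frattini I r"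
proof
  assume "pr w \<in> Frattini (W Mod V) T"
  then obtain f where f: "f \<in> W_Frattini I r" "pr w = pr f"
    by (auto simp: Frattini_Mod)
  have fc: "f \<in> carrier W" using f(1) by (rule W_Frattini_carrier)
  have "pr (w \<otimes>\<^bsub>W\<^esub> f) = pr (f \<otimes>\<^bsub>W\<^esub> f)"
    using assms fc f(2) by (simp add: pr.hom_mult)
  then have "w \<otimes>\<^bsub>W\<^esub> f \<in> V"
    using W_Frattini_square[OF f(1)] assms fc pr_eq_one[of "w \<otimes>\<^bsub>W\<^esub> f"] pr.hom_one by simp
  then have "(w \<otimes>\<^bsub>W\<^esub> f) \<otimes>\<^bsub>W\<^esub> f \<in> W_Frattini I r"
    using V_Frattini f(1) W_Frattini_mult_closed by blast
  then show "w \<in> W_Frattini I r"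
    using W_Frattini_square[OF f(1)] assms fc by (simp add: W.m_assoc)
qed (auto simp: Frattini_Mod)

lemma central_if_Frattini:
  assumes "C \<in> Frattini (W Mod V) T"
  shows "central (W Mod V) C"
proof -
  obtain w where w: "w \<in> W_Frattini I r" "C = pr w"
    using assms by (auto simp: Frattini_Mod)
  have "pr w \<otimes>\<^bsub>W Mod V\<^esub> pr x = pr x \<otimes>\<^bsub>W Mod V\<^esub> pr w" if "x \<in> carrier W" for x
    using pr.hom_mult[OF W_Frattini_carrier[OF w(1)] that]
      pr.hom_mult[OF that W_Frattini_carrier[OF w(1)]] W_Frattini_central[OF w(1) that]
    by metis
  then show ?thesis
    using w W_Frattini_carrier by (auto simp: central_def Mod_carrier)
qed

text \<open>
  Tested against an element with arbitrary last component \<open>\<gamma>'\<close>.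
\<close>

lemma commutator_mem_if_central:
  assumes "(\<alpha>, \<beta>, \<gamma>) \<in> carrier W" "central (W Mod V) (pr (\<alpha>, \<beta>, \<gamma>))"
  shows "commutator_elt \<gamma> \<gamma>' \<in> V"
proof -
  let ?x = "(\<alpha>, \<beta>, \<gamma>)" and ?c = "commutator_elt \<gamma> (restrict \<gamma>' I)"
  let ?y = "(restrict (\<lambda>_. 0) I, restrict (\<lambda>_. 0) (r - Id), restrict \<gamma>' I) :: 'i gal_elt"
  have y: "?y \<in> carrier W" by (simp add: W_carrier)
  have c: "?c \<in> carrier W" using commutator_elt_Frattini W_Frattini_carrier by blast
  have "pr ?x \<otimes>\<^bsub>W Mod V\<^esub> pr ?y = pr ?y \<otimes>\<^bsub>W Mod V\<^esub> pr ?x"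
    using assms(2) y Mod_carrier by (auto simp: central_def)
  then have "pr (?x \<otimes>\<^bsub>W\<^esub> ?y) = pr (?y \<otimes>\<^bsub>W\<^esub> ?x)"
    using assms(1) y by (simp add: pr.hom_mult)
  then have "pr ?c \<otimes>\<^bsub>W Mod V\<^esub> pr (?y \<otimes>\<^bsub>W\<^esub> ?x) = pr (?y \<otimes>\<^bsub>W\<^esub> ?x)"
    using W_commutator[OF assms(1) y] c assms(1) y
    by (metis pr.hom_mult W_mult_closed)
  then have "pr ?c = \<one>\<^bsub>W Mod V\<^esub>"
    using c assms(1) y by (metis Q.r_cancel_one' pr.hom_closed W_mult_closed)
  then have "?c \<in> V" using pr_eq_one[OF c] by blast
  moreover have "?c = commutator_elt \<gamma> \<gamma>'"
    by (auto simp: commutator_elt_def fun_eq_iff order_field)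
  ultimately show ?thesis by simp
qed

end

section \<open>Coordinates with respect to a basis\<close>

text \<open>
  In exponent 2 the common factors cancel. In multiplicative notation this is used for \<open>G\<close>, in
  additive notation for \<open>k\<^sub>*(G)\<close>; the supports of coefficient functions add up in the same way.
\<close>

lemma (in comm_group) finprod_sym_diff:
  assumes two: "\<And>x. x \<in> carrier G \<Longrightarrow> x \<otimes> x = \<one>"
    and fin: "finite A" "finite C" and f: "f \<in> A \<rightarrow> carrier G" "f \<in> C \<rightarrow> carrier G"
  shows "finprod G f ((A - C) \<union> (C - A)) = finprod G f A \<otimes> finprod G f C"
proof -
  let ?a = "finprod G f (A - C)" and ?c = "finprod G f (C - A)" and ?m = "finprod G f (A \<inter> C)"
  have f': "f \<in> A - C \<rightarrow> carrier G" "f \<in> C - A \<rightarrow> carrier G" "f \<in> A \<inter> C \<rightarrow> carrier G"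
    using f by auto
  note closed = f'[THEN finprod_closed]
  have "(A - C) \<union> (A \<inter> C) = A" "(C - A) \<union> (A \<inter> C) = C" by auto
  then have "finprod G f A = ?a \<otimes> ?m" "finprod G f C = ?c \<otimes> ?m"
    using finprod_Un_disjoint[of "A - C" "A \<inter> C" f] finprod_Un_disjoint[of "C - A" "A \<inter> C" f] fin f'
    by auto
  then have "finprod G f A \<otimes> finprod G f C = (?a \<otimes> ?c) \<otimes> (?m \<otimes> ?m)"
    using closed by (simp add: m_ac)
  also have "\<dots> = ?a \<otimes> ?c"
    using closed two by simp
  also have "\<dots> = finprod G f ((A - C) \<union> (C - A))"
    using fin f' by (intro finprod_Un_disjoint[symmetric]) auto
  finally show ?thesis by simp
qed

lemma sum_sym_diff_bit:
  fixes f :: "'b \<Rightarrow> bit"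
  assumes "finite A" "finite C"
  shows "sum f ((A - C) \<union> (C - A)) = sum f A + sum f C"
proof -
  have "sum f ((A - C) \<union> (C - A)) = sum f (A - C) + sum f (C - A)"
    using assms by (intro sum.union_disjoint) auto
  moreover have "sum f A = sum f (A \<inter> C) + sum f (A - C)" "sum f C = sum f (A \<inter> C) + sum f (C - A)"
    using sum.Int_Diff[OF assms(1), of f C] sum.Int_Diff[OF assms(2), of f A] by (simp_all add: Int_commute)
  ultimately show ?thesis
    by (simp add: add_ac)
qed

lemma finsum_bit_ring: "finite A \<Longrightarrow> finsum bit_ring f A = sum f A"
proof (induction A rule: finite_induct)
  interpret ring bit_ring by (rule bit_ring_ring)
  {
    case empty
    show ?case by simp
  next
    case (insert x A)
    then show ?case by simp
  }
qed

locale based_special_group = special_group G + well_ordered_index I r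
  for G :: "('a, 'm) special_group_scheme" (structure) and I :: "'i set" and r :: "'i rel" +
  fixes B :: "'i \<Rightarrow> 'a"
  assumes basis: "well_ordered_basis G I r B"
begin

lemma basis_closed: "i \<in> I \<Longrightarrow> B i \<in> carrier G"
  using basis by (auto simp: well_ordered_basis_def)

lemma basis_Pi: "J \<subseteq> I \<Longrightarrow> B \<in> J \<rightarrow> carrier G"
  using basis_closed by auto

lemma finprod_basis_inject:
  assumes "finite J" "J \<subseteq> I" "finite K" "K \<subseteq> I" "finprod G B J = finprod G B K"
  shows "J = K"
proof -
  have "finprod G B ((J - K) \<union> (K - J)) = finprod G B J \<otimes> finprod G B K"
    using assms by (intro finprod_sym_diff square_one basis_Pi)
  also have "\<dots> = \<one>"
    unfolding assms(5) using assms by (intro square_one finprod_closed basis_Pi)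
  finally have "(J - K) \<union> (K - J) = {}"
    using basis assms unfolding well_ordered_basis_def by (metis Diff_subset Un_least finite_Diff finite_UnI subset_trans)
  then show ?thesis by blast
qed

lemma basis_support_finprod:
  assumes "finite J" "J \<subseteq> I"
  shows "basis_support G I B (finprod G B J) = J"
  unfolding basis_support_def using assms finprod_basis_inject by (intro the_equality) auto

lemma basis_support:
  assumes "a \<in> carrier G"
  shows "finite (basis_support G I B a)" "basis_support G I B a \<subseteq> I"
    "finprod G B (basis_support G I B a) = a"
proof -
  obtain J where "finite J" "J \<subseteq> I" "finprod G B J = a"
    using basis assms by (auto simp: well_ordered_basis_def)
  then show "finite (basis_support G I B a)" "basis_support G I B a \<subseteq> I"
    "finprod G B (basis_support G I B a) = a"
    using basis_support_finprod by auto
qed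

lemma basis_induct [consumes 1, case_names one basis]:
  assumes a: "a \<in> carrier G" and one: "P \<one>"
    and step: "\<And>i a. i \<in> I \<Longrightarrow> a \<in> carrier G \<Longrightarrow> P a \<Longrightarrow> P (B i \<otimes> a)"
  shows "P a"
proof -
  have "P (finprod G B J)" if "finite J" "J \<subseteq> I" for J
    using that
  proof (induction J rule: finite_induct)
    case empty
    show ?case using one by simp
  next
    case (insert i J)
    then have "finprod G B (insert i J) = B i \<otimes> finprod G B J"
      by (intro finprod_insert) (auto simp: basis_closed)
    moreover have "finprod G B J \<in> carrier G"
      using insert by (intro finprod_closed basis_Pi) auto
    ultimately show ?case using insert step by auto
  qed
  then show ?thesis using basis_support[OF a] by metis
qed

definition linear_extension :: "('i \<Rightarrow> bit) \<Rightarrow> 'a \<Rightarrow> bit"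
  where "linear_extension \<gamma> a = (\<Sum>i \<in> basis_support G I B a. \<gamma> i)"

lemma linear_extension_mult:
  assumes "a \<in> carrier G" "b \<in> carrier G"
  shows "linear_extension \<gamma> (a \<otimes> b) = linear_extension \<gamma> a + linear_extension \<gamma> b"
proof -
  let ?S = "basis_support G I B a" and ?S' = "basis_support G I B b"
  note S = basis_support[OF assms(1)] and S' = basis_support[OF assms(2)]
  have "finprod G B ((?S - ?S') \<union> (?S' - ?S)) = finprod G B ?S \<otimes> finprod G B ?S'"
    using S(1,2) S'(1,2) by (intro finprod_sym_diff square_one basis_Pi)
  then have "finprod G B ((?S - ?S') \<union> (?S' - ?S)) = a \<otimes> b"
    using S(3) S'(3) by simp
  moreover have "finite ((?S - ?S') \<union> (?S' - ?S))" "(?S - ?S') \<union> (?S' - ?S) \<subseteq> I"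
    using S S' by auto
  ultimately have "basis_support G I B (a \<otimes> b) = (?S - ?S') \<union> (?S' - ?S)"
    using basis_support_finprod by metis
  then show ?thesis
    using S(1) S'(1) by (simp add: linear_extension_def sum_sym_diff_bit)
qed

lemma linear_extension_basis:
  assumes "i \<in> I"
  shows "linear_extension \<gamma> (B i) = \<gamma> i"
proof -
  have "finprod G B {i} = B i"
    using finprod_insert[of "{}" i B] assms basis_closed by simp
  then show ?thesis
    using basis_support_finprod[of "{i}"] assms by (simp add: linear_extension_def)
qed

section \<open>Bilinear forms and the quadratic relations\<close>

text \<open>
  The quadratic polynomial with support \<open>S\<close> is mapped to \<open>x\<close> in \<open>k\<^sub>2(G)\<close> and takes the value
  \<open>v\<close> at the bilinear form \<open>c\<close>.
\<close>

definition quadratic_rep :: "('a \<Rightarrow> 'a \<Rightarrow> bit) \<Rightarrow> ('a list \<Rightarrow> bit) set set \<Rightarrow> bit \<Rightarrow> bool"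
  where "quadratic_rep c x v \<longleftrightarrow> (\<exists>S. finite S \<and> S \<subseteq> r \<and>
    finsum (k_ring G) (\<lambda>(i, j). kprod G (B i) (B j)) S = x \<and> (\<Sum>(i, j) \<in> S. c (B i) (B j)) = v)"

lemma kprod_basis_Pi: "S \<subseteq> r \<Longrightarrow> (\<lambda>(i, j). kprod G (B i) (B j)) \<in> S \<rightarrow> carrier (k_ring G)"
  using order_field by (auto intro!: kprod_closed basis_closed)

lemma quadratic_rep_zero: "quadratic_rep c \<zero>\<^bsub>k_ring G\<^esub> 0"
proof -
  interpret K: ring "k_ring G" by (rule k_ring_ring)
  show ?thesis
    unfolding quadratic_rep_def by (rule exI[of _ "{}"]) simp
qed

lemma quadratic_rep_add:
  assumes "quadratic_rep c x v" "quadratic_rep c y u"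
  shows "quadratic_rep c (x \<oplus>\<^bsub>k_ring G\<^esub> y) (v + u)"
proof -
  interpret K: ring "k_ring G" by (rule k_ring_ring)
  let ?f = "\<lambda>(i, j). kprod G (B i) (B j)"
  obtain S where S: "finite S" "S \<subseteq> r" "finsum (k_ring G) ?f S = x" "(\<Sum>(i, j) \<in> S. c (B i) (B j)) = v"
    using assms(1) unfolding quadratic_rep_def by blast
  obtain S' where S': "finite S'" "S' \<subseteq> r" "finsum (k_ring G) ?f S' = y"
    "(\<Sum>(i, j) \<in> S'. c (B i) (B j)) = u"
    using assms(2) unfolding quadratic_rep_def by blast
  have "finsum (k_ring G) ?f ((S - S') \<union> (S' - S)) = x \<oplus>\<^bsub>k_ring G\<^esub> y"
    using comm_group.finprod_sym_diff[OF K.a_comm_group, of S S' ?f] S S' k_char_two kprod_basis_Pi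
    by (simp add: finsum_def)
  moreover have "(\<Sum>(i, j) \<in> (S - S') \<union> (S' - S). c (B i) (B j)) = v + u"
    using sum_sym_diff_bit[OF S(1) S'(1)] S(4) S'(4) by simp
  moreover have "finite ((S - S') \<union> (S' - S))" "(S - S') \<union> (S' - S) \<subseteq> r"
    using S S' by auto
  ultimately show ?thesis
    unfolding quadratic_rep_def by blast
qed

text \<open>
  For \<open>j < i\<close> the monomial is \<open>z\<^sub>jz\<^sub>i\<close>; commutativity of \<open>k\<^sub>2(G)\<close> and symmetry of \<open>c\<close>
  make up for the change of order.
\<close>

lemma quadratic_rep_basis:
  assumes sym: "\<And>a b. a \<in> carrier G \<Longrightarrow> b \<in> carrier G \<Longrightarrow> c a b = c b a"
    and ij: "i \<in> I" "j \<in> I"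
  shows "quadratic_rep c (kprod G (B i) (B j)) (c (B i) (B j))"
proof -
  interpret K: ring "k_ring G" by (rule k_ring_ring)
  have single: "quadratic_rep c (kprod G (B i) (B j)) (c (B i) (B j))" if "(i, j) \<in> r" for i j
    unfolding quadratic_rep_def
  proof (intro exI[of _ "{(i, j)}"] conjI)
    show "finsum (k_ring G) (\<lambda>(i, j). kprod G (B i) (B j)) {(i, j)} = kprod G (B i) (B j)"
      using that order_field[OF that] K.finsum_insert[of "{}" "(i, j)" "\<lambda>(i, j). kprod G (B i) (B j)"]
      by (simp add: kprod_closed basis_closed)
  qed (use that in simp_all)
  consider "(i, j) \<in> r" | "(j, i) \<in> r"
    using order_total[OF ij] order_refl[OF ij(1)] by blast
  then show ?thesis
  proof cases
    case 2
    then show ?thesis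
      using single[of j i] kprod_commute sym ij basis_closed by simp
  qed (rule single)
qed

text \<open>
  Expand \<open>a\<close> and \<open>b\<close> in the basis. The existence of a common polynomial for both values avoids
  an explicit formula for its coefficients.
\<close>

lemma quadratic_rep_product:
  assumes sym: "\<And>a b. a \<in> carrier G \<Longrightarrow> b \<in> carrier G \<Longrightarrow> c a b = c b a"
    and add: "\<And>a a' b. a \<in> carrier G \<Longrightarrow> a' \<in> carrier G \<Longrightarrow> b \<in> carrier G
      \<Longrightarrow> c (a \<otimes> a') b = c a b + c a' b"
    and ab: "a \<in> carrier G" "b \<in> carrier G"
  shows "quadratic_rep c (kprod G a b) (c a b)"
proof -
  have c_one: "c \<one> b = 0" if "b \<in> carrier G" for b
    using add[of \<one> \<one> b] that by simp
  have left: "quadratic_rep c (kprod G a (B j)) (c a (B j))" if a: "a \<in> carrier G" and j: "j \<in> I" for a j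
    using a
  proof (induction rule: basis_induct)
    case one
    show ?case
      using c_one j basis_closed quadratic_rep_zero by (simp add: kprod_one)
  next
    case (basis i a)
    then show ?case
      using quadratic_rep_add[OF quadratic_rep_basis[OF sym _ j] basis(3)] j basis_closed add
      by (simp add: kprod_mult_left)
  qed
  have "quadratic_rep c (kprod G b a) (c b a)"
    using ab(2)
  proof (induction rule: basis_induct)
    case one
    show ?case
      using c_one ab quadratic_rep_zero by (simp add: kprod_one)
  next
    case (basis i b)
    have "quadratic_rep c (kprod G (B i) a) (c (B i) a)"
      using left[OF ab(1) basis(1)] sym kprod_commute ab basis_closed[OF basis(1)] by simp
    then show ?case
      using quadratic_rep_add[OF _ basis(3)] basis basis_closed add ab
      by (simp add: kprod_mult_left)
  qed
  then show ?thesis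
    using sym kprod_commute ab by simp
qed

text \<open>
  The bridge between the Galois group and K-theory: if the coordinates of an element of \<open>V\<close> are
  the values of a symmetric bilinear form \<open>c\<close> on the basis, then \<open>c(a,b)\<close> depends only on
  \<open>l(a)l(b)\<close>.
\<close>

lemma V_annihilates_products:
  assumes V: "(\<alpha>, \<beta>, \<gamma>) \<in> V_group G I r B"
    and \<alpha>: "\<And>i. i \<in> I \<Longrightarrow> \<alpha> i = c (B i) (B i)"
    and \<beta>: "\<And>i j. (i, j) \<in> r - Id \<Longrightarrow> \<beta> (i, j) = c (B i) (B j)"
    and sym: "\<And>a b. a \<in> carrier G \<Longrightarrow> b \<in> carrier G \<Longrightarrow> c a b = c b a"
    and add: "\<And>a a' b. a \<in> carrier G \<Longrightarrow> a' \<in> carrier G \<Longrightarrow> b \<in> carrier G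
      \<Longrightarrow> c (a \<otimes> a') b = c a b + c a' b"
    and ab: "a \<in> carrier G" "b \<in> carrier G" "kprod G a b = \<zero>\<^bsub>k_ring G\<^esub>"
  shows "c a b = 0"
proof -
  obtain S where S: "finite S" "S \<subseteq> r"
    "finsum (k_ring G) (\<lambda>(i, j). kprod G (B i) (B j)) S = \<zero>\<^bsub>k_ring G\<^esub>"
    and sum: "(\<Sum>(i, j) \<in> S. c (B i) (B j)) = c a b"
    using quadratic_rep_product[OF sym add ab(1,2)] ab(3) unfolding quadratic_rep_def by auto
  define q :: "'i \<times> 'i \<Rightarrow> bit" where "q p = (if p \<in> S then 1 else 0)" for p
  have supp: "{p. q p \<noteq> 0} = S" by (auto simp: q_def)
  have "q \<in> Q2 G r B"
    using S by (simp add: Q2_def P2_def supp)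
  then have "0 = W_pairing (\<alpha>, \<beta>, \<gamma>) q"
    using V by (simp add: V_group_def)
  also have "\<dots> = (\<Sum>(i, j) \<in> S. c (B i) (B j))"
    unfolding W_pairing_def prod.case supp
  proof (rule sum.cong)
    fix p assume p: "p \<in> S"
    then obtain i j where ij: "p = (i, j)" "(i, j) \<in> r" using S(2) by (cases p) auto
    then show "(case p of (i, j) \<Rightarrow> q (i, j) * (if i = j then \<alpha> i else \<beta> (i, j)))
        = (case p of (i, j) \<Rightarrow> c (B i) (B j))"
      using p \<alpha> \<beta> order_field by (auto simp: q_def)
  qed simp
  finally show ?thesis using sum by simp
qed

section \<open>Involutions and sign characters\<close>

sublocale central_quotient I r "V_group G I r B"
proof (intro central_quotient.intro central_quotient_axioms.intro well_ordered_index_axioms)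
  have Q: "Q2 G r B \<subseteq> P2 r" by (auto simp: Q2_def)
  show "subgroup (V_group G I r B) (W_group I r)"
    unfolding V_group_def by (rule annihilator_subgroup[OF Q])
  show "V_group G I r B \<subseteq> W_Frattini I r"
    by (auto simp: V_group_def)
qed

lemma sign_character_if_square:
  assumes sq: "square_elt \<gamma> \<in> V_group G I r B" and i: "i \<in> I" "\<gamma> i \<noteq> 0"
  shows "sign_character (linear_extension \<gamma>)"
proof -
  let ?f = "linear_extension \<gamma>"
  have "?f a * ?f (a \<otimes> b) = 0" if b: "b \<in> carrier G" and a: "a \<in> repr G b" for a b
  proof (rule V_annihilates_products[where c = "\<lambda>a b. ?f a * ?f b"])
    show "(restrict \<gamma> I, restrict (\<lambda>(i, j). \<gamma> i * \<gamma> j) (r - Id), restrict (\<lambda>_. 0) I) \<in> V_group G I r B"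
      using sq by (simp add: square_elt_def)
    show "kprod G a (a \<otimes> b) = \<zero>\<^bsub>k_ring G\<^esub>"
      by (rule kprod_relation[OF b a])
  qed (use repr_closed[OF a] b order_field in
      \<open>auto simp: linear_extension_basis linear_extension_mult algebra_simps\<close>)
  moreover have "?f (B i) \<noteq> 0"
    using i by (simp add: linear_extension_basis)
  ultimately show ?thesis
    using linear_extension_mult basis_closed[OF i(1)] unfolding sign_character_def by blast
qed

text \<open>
  The pairing with the square of \<open>(0, 0, f)\<close> is the evaluation of \<open>k\<^sub>*(G)\<close> at \<open>f\<close>.
\<close>

lemma square_mem_if_sign_character:
  assumes f: "sign_character f"
  shows "square_elt (\<lambda>i. f (B i)) \<in> V_group G I r B"
proof -
  interpret K: ring "k_ring G" by (rule k_ring_ring)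
  have f_mult: "\<And>a b. a \<in> carrier G \<Longrightarrow> b \<in> carrier G \<Longrightarrow> f (a \<otimes> b) = f a + f b"
    and f_rel: "\<And>a b. b \<in> carrier G \<Longrightarrow> a \<in> repr G b \<Longrightarrow> f a * f (a \<otimes> b) = 0"
    using f unfolding sign_character_def by blast+
  obtain h where h: "h \<in> ring_hom (k_ring G) bit_ring"
    and h_prod: "\<And>a b. a \<in> carrier G \<Longrightarrow> b \<in> carrier G \<Longrightarrow> h (kprod G a b) = f a * f b"
    using k_ring_evaluation[OF f_mult f_rel] by blast
  interpret h: ring_hom_ring "k_ring G" bit_ring h
    by (rule ring_hom_ringI2[OF k_ring_ring bit_ring_ring h])
  have "W_pairing (square_elt (\<lambda>i. f (B i))) q = 0" if q: "q \<in> Q2 G r B" for q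
  proof -
    let ?S = "{p. q p \<noteq> 0}"
    let ?f = "\<lambda>(i, j). kprod G (B i) (B j)"
    have S: "finite ?S" "?S \<subseteq> r" and zero: "finsum (k_ring G) ?f ?S = \<zero>\<^bsub>k_ring G\<^esub>"
      using q by (auto simp: Q2_def P2_def)
    have "W_pairing (square_elt (\<lambda>i. f (B i))) q = (\<Sum>p \<in> ?S. (h \<circ> ?f) p)"
      unfolding W_pairing_def square_elt_def prod.case
    proof (rule sum.cong)
      fix p assume p: "p \<in> ?S"
      then obtain i j where ij: "p = (i, j)" "(i, j) \<in> r" using S(2) by (cases p) auto
      then have "i \<in> I" "j \<in> I" "q (i, j) = 1"
        using order_field p by (auto simp: bit_not_zero_iff)
      then show "(case p of (i, j) \<Rightarrow> q (i, j) * (if i = j then restrict (\<lambda>i. f (B i)) I i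
            else restrict (\<lambda>(i, j). f (B i) * f (B j)) (r - Id) (i, j))) = (h \<circ> ?f) p"
        using ij by (auto simp: h_prod basis_closed)
    qed simp
    also have "\<dots> = finsum bit_ring (h \<circ> ?f) ?S"
      using S by (simp only: finsum_bit_ring)
    also have "\<dots> = h (finsum (k_ring G) ?f ?S)"
      by (rule h.hom_finsum[OF kprod_basis_Pi[OF S(2)], symmetric])
    also have "\<dots> = 0" using zero h.hom_zero by simp
    finally show ?thesis .
  qed
  then show ?thesis
    using square_elt_Frattini by (simp add: V_group_def)
qed

lemma involution_mem_Frattini:
  assumes "\<not> formally_real G" "involution (W Mod V_group G I r B) C"
  shows "C \<in> Frattini (W Mod V_group G I r B) T"
proof -
  obtain w where w: "w \<in> carrier W" "C = pr w"
    using assms(2) by (auto simp: involution_def Mod_carrier)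
  obtain \<alpha> \<beta> \<gamma> where w_eq: "w = (\<alpha>, \<beta>, \<gamma>)" by (cases w)
  have "square_elt \<gamma> \<in> V_group G I r B"
    using assms(2) w(1) W_square[of \<alpha> \<beta> \<gamma>] involution_pr[OF w(1)] unfolding w(2) w_eq by simp
  then have "\<forall>i \<in> I. \<gamma> i = 0"
    using sign_character_if_square sign_character_imp_formally_real assms(1) by blast
  then have "w \<in> W_Frattini I r"
    using w(1) unfolding w_eq by (simp add: W_Frattini_iff)
  then show ?thesis
    using w pr_Frattini_iff by simp
qed

text \<open>
  A central involution with nonzero last component \<open>f\<close> forces all coordinate vectors to be
  multiples of \<open>f\<close>, so that the basis is a singleton. As \<open>f\<close> does not vanish there, the
  relation module is zero, \<open>V\<close> is all of \<open>{\<gamma> = 0}\<close>, and only the value of \<open>\<gamma>\<close> survives.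
\<close>

lemma card_le_two_if_involutions_central:
  assumes fr: "formally_real G"
    and central: "\<And>C. involution (W Mod V_group G I r B) C \<Longrightarrow> central (W Mod V_group G I r B) C"
  shows "finite (carrier (W Mod V_group G I r B)) \<and> card (carrier (W Mod V_group G I r B)) \<le> 2"
proof -
  obtain f where f: "sign_character f"
    using formally_real_imp_sign_character[OF fr] .
  have f_mult: "f (a \<otimes> b) = f a + f b" if "a \<in> carrier G" "b \<in> carrier G" for a b
    using f that unfolding sign_character_def by blast
  have f_one: "f \<one> = 0" using f_mult[of \<one> \<one>] by simp
  have f_mone: "f (mone G) = 1" by (rule sign_character_mone[OF f])
  have sq: "square_elt (\<lambda>i. f (B i)) \<in> V_group G I r B"
    by (rule square_mem_if_sign_character[OF f])
  \<comment> \<open>A sign character is nonzero, hence nonzero on some basis element.\<close>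
  have "\<exists>i \<in> I. f (B i) = 1"
  proof (rule ccontr)
    assume none: "\<not> ?thesis"
    have "f a = 0" if "a \<in> carrier G" for a
      using that
    proof (induction rule: basis_induct)
      case (basis i a)
      then show ?case using none f_mult basis_closed by (simp add: bit_not_one_iff)
    qed (rule f_one)
    then show False using f_mone mone_closed by force
  qed
  then obtain i where i: "i \<in> I" "f (B i) = 1" by blast
  define w :: "'i gal_elt"
    where "w = (restrict (\<lambda>_. 0) I, restrict (\<lambda>_. 0) (r - Id), restrict (\<lambda>i. f (B i)) I)"
  have w: "w \<in> carrier W" by (simp add: w_def W_carrier)
  have "w \<notin> W_Frattini I r"
    using i by (auto simp: w_def W_Frattini_iff intro: bexI[of _ i])
  moreover have "w \<otimes>\<^bsub>W\<^esub> w = square_elt (\<lambda>i. f (B i))"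
    using w W_square[of "restrict (\<lambda>_. 0) I" "restrict (\<lambda>_. 0) (r - Id)" "restrict (\<lambda>i. f (B i)) I"]
    by (auto simp: w_def square_elt_def fun_eq_iff order_field)
  ultimately have "involution (W Mod V_group G I r B) (pr w)"
    using sq involution_pr[OF w] V_Frattini by auto
  then have cen: "central (W Mod V_group G I r B) (pr w)" by (rule central)
  have comm: "commutator_elt (\<lambda>i. f (B i)) \<gamma> \<in> V_group G I r B" for \<gamma>
  proof -
    have "commutator_elt (restrict (\<lambda>i. f (B i)) I) \<gamma> \<in> V_group G I r B"
      using commutator_mem_if_central w cen unfolding w_def by blast
    moreover have "commutator_elt (restrict (\<lambda>i. f (B i)) I) \<gamma> = commutator_elt (\<lambda>i. f (B i)) \<gamma>"
      by (auto simp: commutator_elt_def fun_eq_iff order_field)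
    ultimately show ?thesis by simp
  qed
  have proportional: "\<gamma> k = f (B k) * linear_extension \<gamma> (mone G)" if k: "k \<in> I" for \<gamma> k
  proof -
    let ?g = "linear_extension \<gamma>"
    have "f (B k) * ?g (neg G (B k)) + ?g (B k) * f (neg G (B k)) = 0"
    proof (rule V_annihilates_products[where c = "\<lambda>a b. f a * ?g b + ?g a * f b"])
      show "(restrict (\<lambda>_. 0) I, restrict (\<lambda>(i, j). f (B i) * \<gamma> j + \<gamma> i * f (B j)) (r - Id),
          restrict (\<lambda>_. 0) I) \<in> V_group G I r B"
        using comm[of \<gamma>] by (simp add: commutator_elt_def)
      show "kprod G (B k) (neg G (B k)) = \<zero>\<^bsub>k_ring G\<^esub>"
        by (rule kprod_neg[OF basis_closed[OF k]])
    qed (use k basis_closed order_field mone_closed in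
        \<open>auto simp: linear_extension_basis linear_extension_mult f_mult neg_def algebra_simps\<close>)
    then have "f (B k) * (?g (mone G) + \<gamma> k) + \<gamma> k * (1 + f (B k)) = 0"
      using k basis_closed mone_closed f_mone
      by (simp add: neg_def linear_extension_mult linear_extension_basis f_mult)
    then show ?thesis
      by (cases "f (B k)"; cases "\<gamma> k"; cases "?g (mone G)") simp_all
  qed
  \<comment> \<open>Apply proportionality to the unit vector at \<open>k\<close>: at \<open>k\<close> itself it shows that the factor is 1, at \<open>i\<close> that it is 0.\<close>
  have unique: "k = i" if k: "k \<in> I" for k
  proof (rule ccontr)
    assume "k \<noteq> i"
    then show False
      using proportional[OF i(1), of "\<lambda>l. if l = k then 1 else 0"]
        proportional[OF k, of "\<lambda>l. if l = k then 1 else 0"] i(2) by simp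
  qed
  have V_eq: "V_group G I r B = W_Frattini I r"
  proof -
    have "{p. q p \<noteq> 0} = {}" if q: "q \<in> Q2 G r B" for q
    proof (rule ccontr)
      assume ne: "{p. q p \<noteq> 0} \<noteq> {}"
      have "{p. q p \<noteq> 0} \<subseteq> {(i, i)}"
        using q order_field unique by (fastforce simp: Q2_def P2_def)
      with ne have supp: "{p. q p \<noteq> 0} = {(i, i)}" by blast
      then have "q (i, i) = 1" by (auto simp: bit_not_zero_iff)
      then have "W_pairing (square_elt (\<lambda>i. f (B i))) q = 1"
        unfolding W_pairing_def square_elt_def prod.case supp using i by simp
      then show False
        using sq q by (simp add: V_group_def)
    qed
    then have "W_pairing x q = 0" if "q \<in> Q2 G r B" for x q
      using that by (cases x) (simp only: W_pairing_def prod.case sum.empty)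
    then show ?thesis
      by (auto simp: V_group_def)
  qed
  have "C \<in> {\<one>\<^bsub>W Mod V_group G I r B\<^esub>, inv\<^bsub>W Mod V_group G I r B\<^esub> pr w}"
    if C: "C \<in> carrier (W Mod V_group G I r B)" for C
  proof -
    obtain x where x: "x \<in> carrier W" "C = pr x"
      using C unfolding Mod_carrier by (rule imageE) blast
    obtain \<alpha> \<beta> \<gamma> where x_eq: "x = (\<alpha>, \<beta>, \<gamma>)" by (cases x)
    show ?thesis
    proof (cases "\<gamma> i = 0")
      case True
      then have "x \<in> V_group G I r B"
        using x unique unfolding V_eq x_eq W_Frattini_iff by blast
      then show ?thesis using x pr_eq_one by simp
    next
      case False
      have "x \<otimes>\<^bsub>W\<^esub> w \<in> W_Frattini I r"
      proof -
        have "snd (snd (x \<otimes>\<^bsub>W\<^esub> w)) k = 0" if "k \<in> I" for k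
          using gamma_mult[OF that, of x w] unique[OF that] i False
          by (simp add: x_eq w_def bit_not_zero_iff)
        then show ?thesis
          using W_mult_closed[OF x(1) w] by (cases "x \<otimes>\<^bsub>W\<^esub> w") (simp add: W_Frattini_iff)
      qed
      then have "pr x \<otimes>\<^bsub>W Mod V_group G I r B\<^esub> pr w = \<one>\<^bsub>W Mod V_group G I r B\<^esub>"
        using pr_eq_one[OF W_mult_closed[OF x(1) w]] pr.hom_mult[OF x(1) w] V_eq by simp
      then have "inv\<^bsub>W Mod V_group G I r B\<^esub> pr w = pr x"
        using x(1) w by (intro Q.inv_equality pr.hom_closed)
      then show ?thesis using x(2) by simp
    qed
  qed
  then have sub: "carrier (W Mod V_group G I r B)
      \<subseteq> {\<one>\<^bsub>W Mod V_group G I r B\<^esub>, inv\<^bsub>W Mod V_group G I r B\<^esub> pr w}" (is "_ \<subseteq> ?E")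
    by blast
  moreover have "finite ?E" "card ?E \<le> 2"
    by (simp_all add: card_insert_if)
  ultimately show ?thesis
    using finite_subset card_mono order_trans by meson
qed

end

theorem theorem4p15:
  fixes G :: "'a special_group"
    and I :: "'i set" and r :: "'i rel" and B :: "'i \<Rightarrow> 'a"
  assumes "special_group G"
    and "well_ordered_basis G I r B"
    and "standard G I r B"
  shows "let \<G> = Gal G I r B;
             \<Phi> = Frattini \<G> (Gal_topology G I r B);
             c1 = (\<not> formally_real G);
             c2 = (\<forall>x. involution \<G> x \<longrightarrow> x \<in> \<Phi>);
             c3 = (\<forall>x. involution \<G> x \<longrightarrow> central \<G> x)
         in (c1 \<longrightarrow> c2) \<and> (c2 \<longrightarrow> c3) \<and>
            (infinite (carrier \<G>) \<or> card (carrier \<G>) > 2 \<longrightarrow>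
               (c1 \<longleftrightarrow> c2) \<and> (c2 \<longleftrightarrow> c3))"
proof -
  interpret special_group G by fact
  interpret based_special_group G I r B
    using assms(2) by unfold_locales (auto simp: well_ordered_basis_def)
  have Gal: "Gal G I r B = W Mod V_group G I r B" "Gal_topology G I r B = T"
    by (simp_all add: Gal_def Gal_topology_def)
  have 1: "\<forall>x. involution (Gal G I r B) x \<longrightarrow> x \<in> Frattini (Gal G I r B) (Gal_topology G I r B)"
    if "\<not> formally_real G"
    using involution_mem_Frattini[OF that] unfolding Gal by blast
  have 2: "central (Gal G I r B) x" if "x \<in> Frattini (Gal G I r B) (Gal_topology G I r B)" for x
    using central_if_Frattini that unfolding Gal by blast
  have 3: "\<not> formally_real G"
    if "\<forall>x. involution (Gal G I r B) x \<longrightarrow> central (Gal G I r B) x"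
      and "infinite (carrier (Gal G I r B)) \<or> card (carrier (Gal G I r B)) > 2"
    using card_le_two_if_involutions_central that unfolding Gal by (meson not_le)
  show ?thesis
    unfolding Let_def using 1 2 3 by blast
qed

end
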